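(* Let $V$ be a locally finite-dimensional representation of an $A_{\infty,\infty}$ quiver $\Omega$ with vertices $y_\ell$ ($\ell\in\mathbb{Z}$), and let $C^0$ be any almost gradation of the poset filtration $L^0\cap R^0$ of $V(y_0)$. Then a compatible family $(C^\ell)_{\ell\in\mathbb{Z}}$ extending $C^0$ exists, and for any such family the associated $E_{s,t}$ are subrepresentations of $V$ and $$V=\bigoplus_{s\le t}E_{s,t},$$ where the sum runs over all $s\in\mathbb{Z}\cup\{-\infty\}$ and $t\in\mathbb{Z}\cup\{\infty\}$ with $s\le t$.
   Context: Fix a field $\mathbb{F}$. $\Omega$ is an $A_{\infty,\infty}$ quiver: distinct vertices $y_\ell$ ($\ell\in\mathbb{Z}$), exactly one arrow $a_\ell$ between $y_\ell$ and $y_{\ell+1}$ for each $\ell$ (of arbitrary orientation), and no other arrows. A representation $V$ assigns an $\mathbb{F}$-vector space $V(x)$ to each vertex and a linear map $V(a):V(x)\to V(y)$ to each arrow $a:x\to y$; it is locally finite-dimensional if all $V(x)$ are finite-dimensional. A subrepresentation is a choice of subspaces preserved by all $V(a)$; direct sums are vertexwise. Transport: if $T$ is a linear map between $U$ and $W$ (i.e. $T:U\to W$ or $T:W\to U$) and $A\subseteq U$ is a subspace, the transport of $A$ to $W$ along $T$ is $T(A)$ if $T:U\to W$ and $T^{-1}(A)$ if $T:W\to U$. Transport of a subspace of $V(y_k)$ to $V(y_\ell)$ means successive transport along the maps of the path from $y_k$ to $y_\ell$. A strand of a journey $x_0,x_1,\dots$ (consecutive vertices joined by arrows) is a sequence $(v_0,v_1,\dots)$,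 $v_i\in V(x_i)$, with $V(a)(v_i)=v_{i+1}$ if the arrow is $a:x_i\to x_{i+1}$ and $V(a)(v_{i+1})=v_i$ if it is $a:x_{i+1}\to x_i$. Let $I$ be the totally ordered set $m_0<m_1<m_2<\cdots<n_{-\infty}<\cdots<n_{-2}<n_{-1}<n_0$. Define $L^\ell,R^\ell:I\to\mathrm{Sub}(V(y_\ell))$: for $j\ge0$, $L^\ell_{m_j}$ (resp. $R^\ell_{m_j}$) is the transport to $V(y_\ell)$ of the zero subspace of $V(y_{\ell-j})$ (resp. $V(y_{\ell+j})$); for $j\le0$ in $\mathbb{Z}$, $L^\ell_{n_j}$ (resp. $R^\ell_{n_j}$) is the transport to $V(y_\ell)$ of $V(y_{\ell+j})$ (resp. $V(y_{\ell-j})$); $L^\ell_{n_{-\infty}}$ (resp. $R^\ell_{n_{-\infty}}$) is the set of $v\in V(y_\ell)$ for which there is a strand $(v=v_0,v_1,\dots)$ of $y_\ell,y_{\ell-1},y_{\ell-2},\dots$ (resp. $y_\ell,y_{\ell+1},y_{\ell+2},\dots$). These are linear filtrations. For a poset filtration $F:P\to\mathrm{Sub}(M)$ (order-preserving, with some $F_p=M$), put $F_{<p}=\sum_{q<p}F_q$; an almost gradation of $F$ is a function $C:P\to\mathrm{Sub}(M)$ with $F_p=F_{<p}\oplus C_p$ for all $p$. $L^\ell\cap R^\ell$ is the poset filtration of $V(y_\ell)$ indexed by $I\times I$ (product order) with $(p,q)\mapsto L^\ell_p\cap R^\ell_q$. A compatible family extending $C^0$ is a choice, for each $\ell\in\mathbb{Z}$,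 of an almost gradation $C^\ell$ of $L^\ell\cap R^\ell$ (with $C^0$ the given one) such that for every $\ell\in\mathbb{Z}$ the map $V(a_\ell)$ restricts to an isomorphism (in the direction of $a_\ell$) between the following pairs, with $(-\infty)\pm1=-\infty$: $C^\ell_{m_i,m_{j+1}}$ and $C^{\ell+1}_{m_{i+1},m_j}$ for $i,j\ge1$; $C^\ell_{m_i,n_{j-1}}$ and $C^{\ell+1}_{m_{i+1},n_j}$ for $i\ge1$, $j\in\mathbb{Z}_{\le0}\cup\{-\infty\}$; $C^\ell_{n_i,m_{j+1}}$ and $C^{\ell+1}_{n_{i-1},m_j}$ for $i\in\mathbb{Z}_{\le0}\cup\{-\infty\}$, $j\ge1$; $C^\ell_{n_i,n_{j-1}}$ and $C^{\ell+1}_{n_{i-1},n_j}$ for $i,j\in\mathbb{Z}_{\le0}\cup\{-\infty\}$. For integers $s\le t$ define, for $s\le\ell\le t$, $D^{m,m}_{s,t}(y_\ell)=C^\ell_{m_{1+\ell-s},m_{1+t-\ell}}$, $D^{m,n}_{s,t}(y_\ell)=C^\ell_{m_{1+\ell-s},n_{\ell-t}}$, $D^{n,m}_{s,t}(y_\ell)=C^\ell_{n_{s-\ell},m_{1+t-\ell}}$, $D^{n,n}_{s,t}(y_\ell)=C^\ell_{n_{s-\ell},n_{\ell-t}}$, and all are $0$ at $y_\ell$ for $\ell\notin[s,t]$. Also $D^{m,n}_{s,\infty}(y_\ell)=C^\ell_{m_{1+\ell-s},n_{-\infty}}$ and $D^{n,n}_{s,\infty}(y_\ell)=C^\ell_{n_{s-\ell},n_{-\infty}}$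 for $\ell\ge s$ (and $0$ for $\ell<s$); $D^{n,m}_{-\infty,t}(y_\ell)=C^\ell_{n_{-\infty},m_{1+t-\ell}}$ and $D^{n,n}_{-\infty,t}(y_\ell)=C^\ell_{n_{-\infty},n_{\ell-t}}$ for $\ell\le t$ (and $0$ for $\ell>t$); $D^{n,n}_{-\infty,\infty}(y_\ell)=C^\ell_{n_{-\infty},n_{-\infty}}$ for all $\ell$. Finally (vertexwise sums) $E_{s,t}=D^{m,m}_{s,t}+D^{m,n}_{s,t}+D^{n,m}_{s,t}+D^{n,n}_{s,t}$ for integers $s\le t$, $E_{s,\infty}=D^{m,n}_{s,\infty}+D^{n,n}_{s,\infty}$, $E_{-\infty,t}=D^{n,m}_{-\infty,t}+D^{n,n}_{-\infty,t}$, $E_{-\infty,\infty}=D^{n,n}_{-\infty,\infty}$. *)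

theory Defs
  imports Main "HOL-Library.Extended_Nat" "HOL-Library.Extended"
    "HOL-Library.Product_Order" "HOL-Library.Set_Algebras"
begin

text \<open>
  The index set \<open>m\<^sub>0 < m\<^sub>1 < \<dots> < n\<^sub>-\<^sub>\<infinity> < \<dots> < n\<^sub>-\<^sub>1 < n\<^sub>0\<close>.  The subscripts of the \<open>n\<close>'s are
  stored negated: \<open>Idx_n k\<close> is \<open>n\<^sub>-\<^sub>k\<close>, and \<open>Idx_n \<infinity>\<close> is \<open>n\<^sub>-\<^sub>\<infinity>\<close>.  Lowering the subscript
  of an \<open>n\<close> by one is therefore \<open>k \<mapsto> k + 1\<close>, which fixes \<open>\<infinity>\<close>.
\<close>

datatype idx = Idx_m nat | Idx_n enat

instantiation idx :: linorder
begin

fun less_eq_idx :: "idx \<Rightarrow> idx \<Rightarrow> bool" where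
  "less_eq_idx (Idx_m i) (Idx_m j) \<longleftrightarrow> i \<le> j"
| "less_eq_idx (Idx_m i) (Idx_n j) \<longleftrightarrow> True"
| "less_eq_idx (Idx_n i) (Idx_m j) \<longleftrightarrow> False"
| "less_eq_idx (Idx_n i) (Idx_n j) \<longleftrightarrow> j \<le> i"

definition less_idx :: "idx \<Rightarrow> idx \<Rightarrow> bool" where
  "less_idx p q \<longleftrightarrow> p \<le> q \<and> \<not> q \<le> p"

instance
proof
  fix p q r :: idx
  show "p < q \<longleftrightarrow> p \<le> q \<and> \<not> q \<le> p" by (rule less_idx_def)
  show "p \<le> p" by (cases p) auto
  show "p \<le> q \<Longrightarrow> q \<le> r \<Longrightarrow> p \<le> r" by (cases p; cases q; cases r) auto
  show "p \<le> q \<Longrightarrow> q \<le> p \<Longrightarrow> p = q" by (cases p; cases q) auto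
  show "p \<le> q \<or> q \<le> p" by (cases p; cases q) auto
qed

end

text \<open>\<open>F\<^sub><\<^sub>p\<close>, the sum of the subspaces \<open>F q\<close> with \<open>q < p\<close> (zero if there are none).\<close>

definition below ::
    "('a::field \<Rightarrow> 'b::ab_group_add \<Rightarrow> 'b) \<Rightarrow> ('p::order \<Rightarrow> 'b set) \<Rightarrow> 'p \<Rightarrow> 'b set" where
  "below scale F p = module.span scale (\<Union>q\<in>{q. q < p}. F q)"

definition direct_sum2 ::
    "('a::field \<Rightarrow> 'b::ab_group_add \<Rightarrow> 'b) \<Rightarrow> 'b set \<Rightarrow> 'b set \<Rightarrow> 'b set \<Rightarrow> bool" where
  "direct_sum2 scale U A B \<longleftrightarrow>
     module.subspace scale A \<and> module.subspace scale B \<and> A + B = U \<and> A \<inter> B = {0}"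

definition almost_gradation ::
    "('a::field \<Rightarrow> 'b::ab_group_add \<Rightarrow> 'b) \<Rightarrow> ('p::order \<Rightarrow> 'b set) \<Rightarrow> ('p \<Rightarrow> 'b set) \<Rightarrow> bool" where
  "almost_gradation scale F C \<longleftrightarrow> (\<forall>p. direct_sum2 scale (F p) (below scale F p) (C p))"

text \<open>\<open>U\<close> is the internal direct sum of the (possibly infinite) family \<open>W j\<close>, \<open>j \<in> J\<close>.\<close>

definition direct_sum ::
    "('a::field \<Rightarrow> 'b::ab_group_add \<Rightarrow> 'b) \<Rightarrow> 'b set \<Rightarrow> 'j set \<Rightarrow> ('j \<Rightarrow> 'b set) \<Rightarrow> bool" where
  "direct_sum scale U J W \<longleftrightarrow>
     (\<forall>j\<in>J. module.subspace scale (W j)) \<and> module.span scale (\<Union>j\<in>J. W j) = U \<and>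
     (\<forall>K w. finite K \<and> K \<subseteq> J \<and> (\<forall>j\<in>K. w j \<in> W j) \<and> (\<Sum>j\<in>K. w j) = 0
        \<longrightarrow> (\<forall>j\<in>K. w j = 0))"

text \<open>
  A representation of an \<open>A\<^sub>\<infinity>\<^sub>,\<^sub>\<infinity>\<close> quiver.  The vertex \<open>y\<^sub>l\<close> is the integer \<open>l\<close>, and the
  \<open>l\<close>-th arrow, joining \<open>l\<close> and \<open>l + 1\<close>, goes from \<open>src l\<close> to \<open>tgt l\<close>.  The spaces \<open>V l\<close> are
  subspaces of an arbitrary ambient vector space (for an abstract family, take its
  direct sum); \<open>f l\<close> matters only on \<open>V (src l)\<close>.
\<close>

locale quiver_rep = vector_space scale
  for scale :: "'a::field \<Rightarrow> 'b::ab_group_add \<Rightarrow> 'b" +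
  fixes src tgt :: "int \<Rightarrow> int"
    and V :: "int \<Rightarrow> 'b set"
    and f :: "int \<Rightarrow> 'b \<Rightarrow> 'b"
  assumes arrow: "(src l = l \<and> tgt l = l + 1) \<or> (src l = l + 1 \<and> tgt l = l)"
    and subspace_V: "subspace (V l)"
    and f_in: "v \<in> V (src l) \<Longrightarrow> f l v \<in> V (tgt l)"
    and f_add: "v \<in> V (src l) \<Longrightarrow> w \<in> V (src l) \<Longrightarrow> f l (v + w) = f l v + f l w"
    and f_scale: "v \<in> V (src l) \<Longrightarrow> f l (scale c v) = scale c (f l v)"
begin

definition locally_finite_dim :: bool where
  "locally_finite_dim \<longleftrightarrow> (\<forall>l. \<exists>B. finite B \<and> B \<subseteq> V l \<and> span B = V l)"

definition subrep :: "(int \<Rightarrow> 'b set) \<Rightarrow> bool" where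
  "subrep W \<longleftrightarrow> (\<forall>l. subspace (W l) \<and> W l \<subseteq> V l) \<and> (\<forall>l. f l ` W (src l) \<subseteq> W (tgt l))"

text \<open>
  Transport of \<open>A \<subseteq> V x\<close> to \<open>V x'\<close>, where \<open>x' = x + 1\<close> or \<open>x' = x - 1\<close>; the arrow joining
  the two vertices is number \<open>min x x'\<close>.
\<close>

definition transport_step :: "int \<Rightarrow> int \<Rightarrow> 'b set \<Rightarrow> 'b set" where
  "transport_step x x' A =
     (let e = min x x' in if src e = x then f e ` A else {v \<in> V x'. f e v \<in> A})"

primrec transport :: "(nat \<Rightarrow> int) \<Rightarrow> nat \<Rightarrow> 'b set \<Rightarrow> 'b set" where
  "transport x 0 A = A"
| "transport x (Suc i) A = transport_step (x i) (x (Suc i)) (transport x i A)"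

definition strand :: "(nat \<Rightarrow> int) \<Rightarrow> (nat \<Rightarrow> 'b) \<Rightarrow> bool" where
  "strand x v \<longleftrightarrow> (\<forall>i. v i \<in> V (x i)) \<and>
     (\<forall>i. let e = min (x i) (x (Suc i)) in
        if src e = x i then f e (v i) = v (Suc i) else f e (v (Suc i)) = v i)"

fun L :: "int \<Rightarrow> idx \<Rightarrow> 'b set" where
  "L l (Idx_m j) = transport (\<lambda>i. l - int j + int i) j {0}"
| "L l (Idx_n (enat j)) = transport (\<lambda>i. l - int j + int i) j (V (l - int j))"
| "L l (Idx_n \<infinity>) = {v \<in> V l. \<exists>w. strand (\<lambda>i. l - int i) w \<and> w 0 = v}"

fun R :: "int \<Rightarrow> idx \<Rightarrow> 'b set" where
  "R l (Idx_m j) = transport (\<lambda>i. l + int j - int i) j {0}"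
| "R l (Idx_n (enat j)) = transport (\<lambda>i. l + int j - int i) j (V (l + int j))"
| "R l (Idx_n \<infinity>) = {v \<in> V l. \<exists>w. strand (\<lambda>i. l + int i) w \<and> w 0 = v}"

definition LR :: "int \<Rightarrow> idx \<times> idx \<Rightarrow> 'b set" where
  "LR l = (\<lambda>(p, q). L l p \<inter> R l q)"

text \<open>
  The map of the \<open>l\<close>-th arrow restricts to an isomorphism, in the direction of the arrow,
  between \<open>A \<subseteq> V l\<close> and \<open>B \<subseteq> V (l + 1)\<close>.
\<close>

definition arrow_iso :: "int \<Rightarrow> 'b set \<Rightarrow> 'b set \<Rightarrow> bool" where
  "arrow_iso l A B \<longleftrightarrow> (if src l = l then bij_betw (f l) A B else bij_betw (f l) B A)"

definition compatible_family ::
    "(idx \<times> idx \<Rightarrow> 'b set) \<Rightarrow> (int \<Rightarrow> idx \<times> idx \<Rightarrow> 'b set) \<Rightarrow> bool" where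
  "compatible_family C0 C \<longleftrightarrow>
     C 0 = C0 \<and> (\<forall>l. almost_gradation scale (LR l) (C l)) \<and>
     (\<forall>l.
       (\<forall>i\<ge>1. \<forall>j\<ge>1.
          arrow_iso l (C l (Idx_m i, Idx_m (j + 1))) (C (l + 1) (Idx_m (i + 1), Idx_m j))) \<and>
       (\<forall>i\<ge>1. \<forall>j.
          arrow_iso l (C l (Idx_m i, Idx_n (j + 1))) (C (l + 1) (Idx_m (i + 1), Idx_n j))) \<and>
       (\<forall>i. \<forall>j\<ge>1.
          arrow_iso l (C l (Idx_n i, Idx_m (j + 1))) (C (l + 1) (Idx_n (i + 1), Idx_m j))) \<and>
       (\<forall>i j.
          arrow_iso l (C l (Idx_n i, Idx_n (j + 1))) (C (l + 1) (Idx_n (i + 1), Idx_n j))))"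

end

text \<open>\<open>m\<^sub>j\<close> for an integer \<open>j \<ge> 0\<close>, and \<open>n\<^sub>j\<close> for an integer \<open>j \<le> 0\<close>.\<close>

abbreviation m_ix :: "int \<Rightarrow> idx" where "m_ix j \<equiv> Idx_m (nat j)"
abbreviation n_ix :: "int \<Rightarrow> idx" where "n_ix j \<equiv> Idx_n (enat (nat (- j)))"
abbreviation n_minf :: idx where "n_minf \<equiv> Idx_n \<infinity>"

context
  fixes C :: "int \<Rightarrow> idx \<times> idx \<Rightarrow> 'b::ab_group_add set"
begin

definition Dmm :: "int \<Rightarrow> int \<Rightarrow> int \<Rightarrow> 'b set" where
  "Dmm s t l = (if s \<le> l \<and> l \<le> t then C l (m_ix (1 + l - s), m_ix (1 + t - l)) else {0})"

definition Dmn :: "int \<Rightarrow> int \<Rightarrow> int \<Rightarrow> 'b set" where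
  "Dmn s t l = (if s \<le> l \<and> l \<le> t then C l (m_ix (1 + l - s), n_ix (l - t)) else {0})"

definition Dnm :: "int \<Rightarrow> int \<Rightarrow> int \<Rightarrow> 'b set" where
  "Dnm s t l = (if s \<le> l \<and> l \<le> t then C l (n_ix (s - l), m_ix (1 + t - l)) else {0})"

definition Dnn :: "int \<Rightarrow> int \<Rightarrow> int \<Rightarrow> 'b set" where
  "Dnn s t l = (if s \<le> l \<and> l \<le> t then C l (n_ix (s - l), n_ix (l - t)) else {0})"

definition Dmn_pinf :: "int \<Rightarrow> int \<Rightarrow> 'b set" where
  "Dmn_pinf s l = (if s \<le> l then C l (m_ix (1 + l - s), n_minf) else {0})"

definition Dnn_pinf :: "int \<Rightarrow> int \<Rightarrow> 'b set" where
  "Dnn_pinf s l = (if s \<le> l then C l (n_ix (s - l), n_minf) else {0})"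

definition Dnm_minf :: "int \<Rightarrow> int \<Rightarrow> 'b set" where
  "Dnm_minf t l = (if l \<le> t then C l (n_minf, m_ix (1 + t - l)) else {0})"

definition Dnn_minf :: "int \<Rightarrow> int \<Rightarrow> 'b set" where
  "Dnn_minf t l = (if l \<le> t then C l (n_minf, n_ix (l - t)) else {0})"

definition Dnn_minf_pinf :: "int \<Rightarrow> 'b set" where
  "Dnn_minf_pinf l = C l (n_minf, n_minf)"

text \<open>The last two equations are junk values outside the range of the parameters.\<close>

fun E :: "int extended \<Rightarrow> int extended \<Rightarrow> int \<Rightarrow> 'b set" where
  "E (Fin s) (Fin t) l = Dmm s t l + Dmn s t l + Dnm s t l + Dnn s t l"
| "E (Fin s) Pinf l = Dmn_pinf s l + Dnn_pinf s l"
| "E Minf (Fin t) l = Dnm_minf t l + Dnn_minf t l"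
| "E Minf Pinf l = Dnn_minf_pinf l"
| "E Pinf _ l = {0}"
| "E _ Minf l = {0}"

end

definition parameters :: "(int extended \<times> int extended) set" where
  "parameters = {(s, t). s \<noteq> Pinf \<and> t \<noteq> Minf \<and> s \<le> t}"

end

theory Submission
  imports Defs
begin

text \<open>
  The graph \<open>T l\<close> of the \<open>l\<close>-th map is a linear relation between \<open>V l\<close> and \<open>V (l + 1)\<close>, whatever the
  orientation of the arrow.  Raising an index by \<open>up\<close>, that is \<open>m\<^sub>j \<mapsto> m\<^sub>j\<^sub>+\<^sub>1\<close> and \<open>n\<^sub>j \<mapsto> n\<^sub>j\<^sub>-\<^sub>1\<close>, one has
  \<open>L (l + 1) (up p) = T l `` L l p\<close> and \<open>R l (up q) = (T l)\<inverse> `` R (l + 1) q\<close>; at \<open>n\<^sub>-\<^sub>\<infinity>\<close> this needs local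
  finite dimensionality.  Hence \<open>T l\<close> induces an isomorphism between the quotients of \<open>LR l\<close> at \<open>(p, up q)\<close>
  and of \<open>LR (l + 1)\<close> at \<open>(up p, q)\<close>, and almost gradations propagate in both directions from \<open>l = 0\<close>.
  An almost gradation of the intersection of two linear filtrations with finitely many steps is a direct
  sum decomposition, and the \<open>E\<^sub>s\<^sub>,\<^sub>t\<close> collect its summands according to the interval on which they live.
\<close>

section \<open>Complements and direct sums\<close>

context vector_space
begin

section \<open>Complements and dimensions of subspaces\<close>

lemma span_Un_plus: "span (A \<union> B) = span A + span B"
  by (auto simp: span_Un set_plus_def)

text \<open>A basis of \<open>A\<close> extends to a basis of \<open>B\<close>; the added vectors
  span a complement.\<close>

lemma complement_exists:
  assumes A: "subspace A" and B: "subspace B" and AB: "A \<subseteq> B"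
  shows "\<exists>C. direct_sum2 scale B A C"
proof -
  obtain X where X: "X \<subseteq> A" "independent X" "A \<subseteq> span X"
    using maximal_independent_subset by blast
  obtain Y where Y: "X \<subseteq> Y" "Y \<subseteq> B" "independent Y" "B \<subseteq> span Y"
    using maximal_independent_subset_extend[of X B] X AB by blast
  have A_eq: "A = span X" and B_eq: "B = span Y"
    using X Y A B span_minimal by blast+
  have "A + span (Y - X) = B"
    using span_Un[of X "Y - X"] Y(1) by (auto simp: A_eq B_eq set_plus_def Un_absorb1)
  moreover have "A \<inter> span (Y - X) = {0}"
  proof -
    \<comment> \<open>A common vector has its \<open>Y\<close>-coordinates supported both in
      \<open>X\<close> and in \<open>Y - X\<close>, so they all vanish.\<close>
    have "v = 0" if v: "v \<in> span X" "v \<in> span (Y - X)" for v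
    proof -
      have "representation Y v = representation X v"
        "representation Y v = representation (Y - X) v"
        using representation_extend[OF Y(3)] v Y(1) by blast+
      then have "representation Y v b = 0" for b
        using representation_ne_zero[of X v b] representation_ne_zero[of "Y - X" v b] by auto
      moreover have "v \<in> span Y" using v span_mono[OF Y(1)] by blast
      ultimately show ?thesis
        using sum_nonzero_representation_eq[OF Y(3), of v] by simp
    qed
    then show ?thesis by (auto simp: A_eq span_zero)
  qed
  ultimately show ?thesis unfolding direct_sum2_def using A by blast
qed

text \<open>A basis of \<open>A\<close> extended to one of \<open>A'\<close> gains a vector; the
  finite spanning set \<open>B\<close> keeps both bases finite, so their cardinalities compare
  strictly.\<close>

lemma dim_strict_mono:
  assumes A: "subspace A" and AA: "A \<subset> A'" and A': "A' \<subseteq> span B" "finite B"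
  shows "dim A < dim A'"
proof -
  obtain X where X: "X \<subseteq> A" "independent X" "A \<subseteq> span X"
    using maximal_independent_subset by blast
  obtain Y where Y: "X \<subseteq> Y" "Y \<subseteq> A'" "independent Y" "A' \<subseteq> span Y"
    using maximal_independent_subset_extend[of X A'] X AA by blast
  have "finite Y" using independent_span_bound[of B Y] Y A' by blast
  moreover have "X \<noteq> Y" using Y AA X A span_minimal[of X A] by blast
  ultimately have "card X < card Y" using Y(1) psubset_card_mono by blast
  then show ?thesis using basis_card_eq_dim X Y by metis
qed

lemma dim_mono:
  assumes A: "subspace A" and AA: "A \<subseteq> A'" and A': "A' \<subseteq> span B" "finite B"
  shows "dim A \<le> dim A'"
  using dim_strict_mono[OF A _ A'] AA by (cases "A = A'") (auto simp: psubset_eq less_imp_le)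

section \<open>Finite sums in spans, and internal direct sums\<close>

lemma span_UN_sum:
  assumes W: "\<And>i. i \<in> I \<Longrightarrow> subspace (W i)" and x: "x \<in> span (\<Union>i\<in>I. W i)"
  shows "\<exists>K u. finite K \<and> K \<subseteq> I \<and> (\<forall>i\<in>K. u i \<in> W i) \<and> x = (\<Sum>i\<in>K. u i)"
  using x
proof (induction rule: span_induct_alt)
  case base
  show ?case by (rule exI[of _ "{}"]) auto
next
  case (step c x y)
  then obtain K u i where *: "finite K" "K \<subseteq> I" "\<forall>i\<in>K. u i \<in> W i" "y = (\<Sum>i\<in>K. u i)"
    "i \<in> I" "x \<in> W i" by blast
  have cx: "c *s x \<in> W i" using * W subspace_scale by blast
  \<comment> \<open>A vector from a summand already in use is merged into the entry of that summand;
    otherwise \<open>K\<close> grows.\<close>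
  show ?case
  proof (cases "i \<in> K")
    case True
    let ?u = "u(i := c *s x + u i)"
    have "sum ?u K = (c *s x + u i) + sum u (K - {i})"
      using * True by (simp add: sum.remove[of K i])
    also have "\<dots> = c *s x + y" using * True by (simp add: sum.remove[of K i] add.assoc)
    finally show ?thesis using * True cx W subspace_add
      by (intro exI[of _ K] exI[of _ ?u]) auto
  next
    case False
    then have "sum (u(i := c *s x)) (insert i K) = c *s x + y"
      using * by (auto intro!: sum.cong)
    then show ?thesis using * cx
      by (intro exI[of _ "insert i K"] exI[of _ "u(i := c *s x)"]) auto
  qed
qed

text \<open>Expanding every grouped component into the original summands turns a relation between
  groups into one between the \<open>W i\<close>, because different fibres of \<open>g\<close> share
  no index. An empty fibre contributes \<open>span {} = {0}\<close>.\<close>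

lemma direct_sum_group:
  assumes ds: "direct_sum scale U I W" and g: "g ` I \<subseteq> J"
  shows "direct_sum scale U J (\<lambda>j. span (\<Union>i\<in>{i\<in>I. g i = j}. W i))"
proof -
  let ?W = "\<lambda>j. span (\<Union>i\<in>{i\<in>I. g i = j}. W i)"
  have W: "\<And>i. i \<in> I \<Longrightarrow> subspace (W i)" and sp: "span (\<Union>i\<in>I. W i) = U"
    and ind: "\<And>K w. finite K \<Longrightarrow> K \<subseteq> I \<Longrightarrow> (\<And>j. j \<in> K \<Longrightarrow> w j \<in> W j) \<Longrightarrow> (\<Sum>j\<in>K. w j) = 0
      \<Longrightarrow> (\<forall>j\<in>K. w j = 0)"
    using ds unfolding direct_sum_def by blast+
  have W_le: "W i \<subseteq> ?W (g i)" if "i \<in> I" for i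
    using that span_superset[of "\<Union>i'\<in>{i'\<in>I. g i' = g i}. W i'"] by auto
  have "(\<Union>i\<in>I. W i) \<subseteq> (\<Union>j\<in>J. ?W j)" 
  proof (intro UN_least)
    fix i assume "i \<in> I"
    then have "g i \<in> J" using g by blast
    then show "W i \<subseteq> (\<Union>j\<in>J. ?W j)" 
      using W_le[OF \<open>i \<in> I\<close>] by (intro subset_trans[OF _ UN_upper])
  qed
  moreover have "(\<Union>j\<in>J. ?W j) \<subseteq> span (\<Union>i\<in>I. W i)" by (intro UN_least span_mono) blast
  ultimately have "span (\<Union>j\<in>J. ?W j) = U" unfolding sp[symmetric]
    by (intro subset_antisym span_minimal span_mono subspace_span)
  moreover have "\<forall>j\<in>K. w j = 0"
    if K: "finite K" "\<forall>j\<in>K. w j \<in> ?W j" and s0: "(\<Sum>j\<in>K. w j) = 0" for K w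
  proof -
    have "\<forall>j\<in>K. \<exists>M. \<exists>u. finite M \<and> M \<subseteq> {i\<in>I. g i = j} \<and> (\<forall>i\<in>M. u i \<in> W i) \<and>
        w j = (\<Sum>i\<in>M. u i)"
    proof
      fix j assume "j \<in> K"
      then show "\<exists>M. \<exists>u. finite M \<and> M \<subseteq> {i\<in>I. g i = j} \<and> (\<forall>i\<in>M. u i \<in> W i) \<and>
          w j = (\<Sum>i\<in>M. u i)"
        using K W by (intro span_UN_sum) auto
    qed
    from bchoice[OF this] obtain M where "\<forall>j\<in>K. \<exists>u. finite (M j) \<and> M j \<subseteq> {i\<in>I. g i = j} \<and>
        (\<forall>i\<in>M j. u i \<in> W i) \<and> w j = (\<Sum>i\<in>M j. u i)" ..
    from bchoice[OF this] obtain u where M: "\<And>j. j \<in> K \<Longrightarrow> finite (M j)"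
        "\<And>j. j \<in> K \<Longrightarrow> M j \<subseteq> {i\<in>I. g i = j}"
        "\<And>j i. j \<in> K \<Longrightarrow> i \<in> M j \<Longrightarrow> u j i \<in> W i"
        "\<And>j. j \<in> K \<Longrightarrow> w j = (\<Sum>i\<in>M j. u j i)"
      by auto
    have gM: "g i = j" "i \<in> I" if "j \<in> K" "i \<in> M j" for i j using M(2)[OF that(1)] that(2) by auto
    \<comment> \<open>On \<open>M j\<close> the label \<open>j\<close> is recovered as
      \<open>g i\<close>, so the double sum becomes one sum over a disjoint union.\<close>
    have "\<forall>i\<in>K. \<forall>j\<in>K. i \<noteq> j \<longrightarrow> M i \<inter> M j = {}" using gM(1) by (metis disjoint_iff)
    then have "(\<Sum>i\<in>(\<Union>j\<in>K. M j). u (g i) i) = (\<Sum>j\<in>K. \<Sum>i\<in>M j. u (g i) i)"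
      using K(1) M(1) by (intro sum.UNION_disjoint) auto
    also have "\<dots> = 0" unfolding s0[symmetric] using M(4) gM(1) by (auto intro!: sum.cong)
    finally have sum0: "(\<Sum>i\<in>(\<Union>j\<in>K. M j). u (g i) i) = 0" .
    have "u (g i) i \<in> W i" if "i \<in> (\<Union>j\<in>K. M j)" for i
      using that M(3) gM(1) by auto
    then have "\<forall>i\<in>(\<Union>j\<in>K. M j). u (g i) i = 0"
      by (rule ind[OF _ _ _ sum0, rotated 2]) (use K(1) M(1) gM(2) in auto)
    then have "u j i = 0" if "j \<in> K" "i \<in> M j" for i j using that gM by auto
    then show ?thesis using M(4) by simp
  qed
  ultimately show ?thesis unfolding direct_sum_def by blast
qed

lemma direct_sum_restrict:
  assumes ds: "direct_sum scale U I W" and "J \<subseteq> I" and "\<And>i. i \<in> I - J \<Longrightarrow> W i = {0}"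
  shows "direct_sum scale U J W"
proof -
  have W: "\<forall>j\<in>I. subspace (W j)" and sp: "span (\<Union>i\<in>I. W i) = U"
    and ind: "\<forall>K w. finite K \<and> K \<subseteq> I \<and> (\<forall>j\<in>K. w j \<in> W j) \<and> (\<Sum>j\<in>K. w j) = 0
      \<longrightarrow> (\<forall>j\<in>K. w j = 0)"
    using ds unfolding direct_sum_def by auto
  have "(\<Union>i\<in>I. W i) \<subseteq> insert 0 (\<Union>i\<in>J. W i)" using assms by blast
  then have "span (\<Union>i\<in>I. W i) \<subseteq> span (\<Union>i\<in>J. W i)"
    by (metis span_insert_0 span_mono)
  moreover have "span (\<Union>i\<in>J. W i) \<subseteq> span (\<Union>i\<in>I. W i)"
    using assms(2) by (intro span_mono UN_mono) auto
  ultimately have "span (\<Union>i\<in>J. W i) = U" using sp by (metis subset_antisym)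
  moreover have "\<forall>j\<in>J. subspace (W j)" using W assms(2) by auto
  moreover have "\<forall>K w. finite K \<and> K \<subseteq> J \<and> (\<forall>j\<in>K. w j \<in> W j) \<and> (\<Sum>j\<in>K. w j) = 0
      \<longrightarrow> (\<forall>j\<in>K. w j = 0)"
    using ind subset_trans[OF _ assms(2)] by (intro allI impI, elim conjE) metis
  ultimately show ?thesis unfolding direct_sum_def by blast
qed

lemma direct_sum_cong:
  assumes ds: "direct_sum scale U J W" and eq: "\<And>j. j \<in> J \<Longrightarrow> W j = W' j"
  shows "direct_sum scale U J W'"
proof -
  have W: "\<forall>j\<in>J. subspace (W j)" and sp: "span (\<Union>j\<in>J. W j) = U"
    and ind: "\<forall>K w. finite K \<and> K \<subseteq> J \<and> (\<forall>j\<in>K. w j \<in> W j) \<and> (\<Sum>j\<in>K. w j) = 0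
      \<longrightarrow> (\<forall>j\<in>K. w j = 0)"
    using ds unfolding direct_sum_def by auto
  have "(\<Union>j\<in>J. W j) = (\<Union>j\<in>J. W' j)" using eq by (rule SUP_cong[OF refl])
  moreover have "\<forall>j\<in>J. subspace (W' j)" using W eq by auto
  moreover have "(\<forall>j\<in>K. w j \<in> W' j) \<longleftrightarrow> (\<forall>j\<in>K. w j \<in> W j)" if "K \<subseteq> J" for K w
    using that eq by auto
  ultimately show ?thesis unfolding direct_sum_def using ind sp
    by (intro conjI) (simp, simp, intro allI impI, elim conjE, metis)
qed

section \<open>Almost gradations of the intersection of two linear filtrations\<close>

lemma subspace_below: "subspace (below scale F p)"
  unfolding below_def by (rule subspace_span)

lemma subset_below: "q < p \<Longrightarrow> F q \<subseteq> below scale F p"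
  unfolding below_def using span_superset[of "\<Union> (F ` {q. q < p})"] by blast

lemma below_subset: "mono F \<Longrightarrow> subspace (F p) \<Longrightarrow> below scale F p \<subseteq> F p"
  unfolding below_def mono_def by (intro span_minimal) (auto dest: less_imp_le)

text \<open>In a vanishing sum consider the lexicographically largest index with a nonzero term: the
  remaining terms add up to a vector of \<open>below\<close> at that index, and a vector of
  \<open>C (p, q)\<close> in \<open>below\<close> is zero.\<close>

lemma almost_gradation_independent:
  fixes F :: "'p::linorder \<Rightarrow> 'b set" and H :: "'q::linorder \<Rightarrow> 'b set"
  assumes F: "mono F" "\<And>p. subspace (F p)" and H: "mono H" "\<And>q. subspace (H q)"
    and C: "almost_gradation scale (\<lambda>(p, q). F p \<inter> H q) C"
    and K: "finite K" "\<And>r. r \<in> K \<Longrightarrow> w r \<in> C r" "(\<Sum>r\<in>K. w r) = 0"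
  shows "\<forall>r\<in>K. w r = 0"
proof (rule ccontr)
  let ?FH = "\<lambda>(p, q). F p \<inter> H q"
  have CFH: "C (p, q) \<subseteq> F p \<inter> H q" for p q
  proof
    fix x assume "x \<in> C (p, q)"
    moreover have "0 \<in> below scale ?FH (p, q)" using subspace_below subspace_0 by blast
    ultimately have "0 + x \<in> below scale ?FH (p, q) + C (p, q)" by blast
    then show "x \<in> F p \<inter> H q" using C unfolding almost_gradation_def direct_sum2_def by auto
  qed
  assume "\<not> (\<forall>r\<in>K. w r = 0)"
  define N where "N = {r\<in>K. w r \<noteq> 0}"
  have N: "finite N" "N \<noteq> {}" using K \<open>\<not> _\<close> by (auto simp: N_def)
  define p where "p = Max (fst ` N)"
  define Q where "Q = {q. (p, q) \<in> N}"
  have "Q \<subseteq> snd ` N" by (force simp: Q_def)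
  then have finQ: "finite Q" using N finite_surj by blast
  have "p \<in> fst ` N" unfolding p_def using N by (intro Max_in) auto
  then have Qne: "Q \<noteq> {}" by (auto simp: Q_def)
  define q where "q = Max Q"
  have qQ: "q \<in> Q" unfolding q_def using finQ Qne by simp
  then have pqN: "(p, q) \<in> N" by (simp add: Q_def)
  have le_p: "p' \<le> p" if "(p', q') \<in> N" for p' q'
    unfolding p_def using N that by (force intro!: Max_ge)
  have le_q: "q' \<le> q" if "(p, q') \<in> N" for q'
    unfolding q_def using finQ that by (intro Max_ge) (auto simp: Q_def)
  define N1 where "N1 = {r\<in>N. fst r < p}"
  define N2 where "N2 = {r\<in>N. fst r = p \<and> snd r < q}"
  have N_split: "N = insert (p, q) (N1 \<union> N2)"
    using pqN le_p le_q by (fastforce simp: N1_def N2_def less_le)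
  have fin12: "finite N1" "finite N2" using N by (auto simp: N1_def N2_def)
  have "0 = (\<Sum>r\<in>N. w r)" using K
    by (metis (mono_tags, lifting) N_def mem_Collect_eq subsetI sum.mono_neutral_cong_right DiffE)
  also have "\<dots> = w (p, q) + (\<Sum>r\<in>N1 \<union> N2. w r)"
    unfolding N_split using fin12 by (subst sum.insert) (auto simp: N1_def N2_def)
  also have "(\<Sum>r\<in>N1 \<union> N2. w r) = (\<Sum>r\<in>N1. w r) + (\<Sum>r\<in>N2. w r)"
    using fin12 by (intro sum.union_disjoint) (auto simp: N1_def N2_def)
  finally have w_eq: "- w (p, q) = (\<Sum>r\<in>N1. w r) + (\<Sum>r\<in>N2. w r)"
    by (simp add: minus_unique)
  let ?B = "below scale ?FH (p, q)"
  have wF: "w r \<in> F (fst r)" "w r \<in> H (snd r)" if "r \<in> N" for r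
    using CFH[of "fst r" "snd r"] K(2)[of r] that by (auto simp: N_def)
  have w2: "(\<Sum>r\<in>N2. w r) \<in> ?B" "(\<Sum>r\<in>N2. w r) \<in> H q"
  proof -
    have "w r \<in> ?B \<and> w r \<in> H q" if "r \<in> N2" for r
    proof -
      have "r < (p, q)" "r \<in> N" "H (snd r) \<subseteq> H q" using that monoD[OF H(1), of "snd r" q]
        by (cases r; auto simp: N2_def less_le)+
      then show ?thesis using subset_below[of r "(p, q)" ?FH] wF[of r] by (cases r) auto
    qed
    then show "(\<Sum>r\<in>N2. w r) \<in> ?B" "(\<Sum>r\<in>N2. w r) \<in> H q"
      by (auto intro: subspace_sum[OF subspace_below] subspace_sum[OF H(2)])
  qed
  \<comment> \<open>Each term of \<open>N1\<close> lies in \<open>F p'\<close> but need not lie in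
    \<open>H q\<close>. Solving \<open>w_eq\<close> for their sum shows that the sum does, so it
    belongs to the smaller index \<open>(p', q)\<close>.\<close>
  have w1: "(\<Sum>r\<in>N1. w r) \<in> ?B"
  proof (cases "N1 = {}")
    case True
    then show ?thesis using subspace_below subspace_0 by auto
  next
    case False
    define p' where "p' = Max (fst ` N1)"
    have "p' \<in> fst ` N1" unfolding p'_def using fin12 False by (intro Max_in) auto
    then have "p' < p" by (auto simp: N1_def)
    have "w r \<in> F p'" if "r \<in> N1" for r
    proof -
      have "fst r \<le> p'" unfolding p'_def using fin12 that by (intro Max_ge) auto
      then show ?thesis using wF[of r] that F(1) by (auto simp: N1_def mono_def)
    qed
    then have "(\<Sum>r\<in>N1. w r) \<in> F p'" by (intro subspace_sum F)
    moreover have "(\<Sum>r\<in>N1. w r) = - w (p, q) - (\<Sum>r\<in>N2. w r)" using w_eq by simp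
    then have "(\<Sum>r\<in>N1. w r) \<in> H q"
      using w2 wF(2)[OF pqN] H(2) subspace_neg subspace_diff by simp
    ultimately have "(\<Sum>r\<in>N1. w r) \<in> ?FH (p', q)" by simp
    moreover have "(p', q) < (p, q)" using \<open>p' < p\<close> by (auto simp: less_le)
    ultimately show ?thesis using subset_below[of "(p', q)" "(p, q)" ?FH] by auto
  qed
  have "- w (p, q) \<in> ?B" unfolding w_eq using w1 w2 subspace_below subspace_add by blast
  then have "w (p, q) \<in> ?B" using subspace_neg[OF subspace_below, of "- w (p, q)"] by simp
  moreover have "w (p, q) \<in> C (p, q)" using K(2) pqN by (auto simp: N_def)
  ultimately have "w (p, q) = 0"
    using C unfolding almost_gradation_def direct_sum2_def by blast
  then show False using pqN by (simp add: N_def)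
qed

text \<open>Induction on the sum of the two dimensions. As the index orders need not be
  well-founded, \<open>p\<close> and \<open>q\<close> are first replaced by the least indices with
  the same values; below these, at least one dimension drops.\<close>

lemma almost_gradation_span:
  fixes F :: "'p::linorder \<Rightarrow> 'b set" and H :: "'q::linorder \<Rightarrow> 'b set"
  assumes F: "mono F" "\<And>p. subspace (F p)" "\<And>p. F p \<subseteq> span B"
    and F0: "\<And>p. \<exists>p0. F p0 = F p \<and> (\<forall>p'<p0. F p' \<noteq> F p)"
    and H: "mono H" "\<And>q. subspace (H q)" "\<And>q. H q \<subseteq> span B"
    and H0: "\<And>q. \<exists>q0. H q0 = H q \<and> (\<forall>q'<q0. H q' \<noteq> H q)"
    and B: "finite B"
    and C: "almost_gradation scale (\<lambda>(p, q). F p \<inter> H q) C"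
  shows "F p \<inter> H q \<subseteq> span (\<Union>r. C r)"
proof (induction "dim (F p) + dim (H q)" arbitrary: p q rule: less_induct)
  case less
  obtain p0 q0 where p0: "F p0 = F p" "\<And>p'. p' < p0 \<Longrightarrow> F p' \<noteq> F p"
    and q0: "H q0 = H q" "\<And>q'. q' < q0 \<Longrightarrow> H q' \<noteq> H q" using F0[of p] H0[of q] by blast
  let ?FH = "\<lambda>(p, q). F p \<inter> H q"
  have "F p' \<inter> H q' \<subseteq> span (\<Union>r. C r)" if pq: "(p', q') < (p0, q0)" for p' q'
  proof -
    have le: "p' \<le> p0" "q' \<le> q0" and ne: "p' < p0 \<or> q' < q0" using pq by (auto simp: less_le)
    have sub: "F p' \<subseteq> F p" "H q' \<subseteq> H q" using le F(1) H(1) p0 q0 unfolding mono_def by blast+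
    then have le': "dim (F p') \<le> dim (F p)" "dim (H q') \<le> dim (H q)"
      using dim_mono[OF F(2) _ F(3) B] dim_mono[OF H(2) _ H(3) B] by simp_all
    have "dim (F p') < dim (F p) \<or> dim (H q') < dim (H q)"
      using ne p0 q0 sub dim_strict_mono[OF F(2) _ F(3) B] dim_strict_mono[OF H(2) _ H(3) B]
      by (meson psubsetI)
    then have "dim (F p') + dim (H q') < dim (F p) + dim (H q)" using le' by linarith
    then show ?thesis by (rule less)
  qed
  then have "below scale ?FH (p0, q0) \<subseteq> span (\<Union>r. C r)"
    unfolding below_def by (intro span_minimal) auto
  moreover have "C (p0, q0) \<subseteq> span (\<Union>r. C r)" using span_superset[of "\<Union>r. C r"] by blast
  moreover have "F p \<inter> H q = below scale ?FH (p0, q0) + C (p0, q0)"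
    using C p0 q0 unfolding almost_gradation_def direct_sum2_def by auto
  ultimately show ?case by (auto simp: set_plus_def intro: span_add)
qed

text \<open>A linear relation inducing an isomorphism \<open>U / N \<cong> U' / N'\<close> carries complements of \<open>N\<close> to
  complements of \<open>N'\<close>, up to the choice of a complement of the indeterminacy \<open>{u'. (0, u') \<in> T}\<close>.\<close>

lemma complement_along_relation:
  assumes T0: "(0, 0) \<in> T"
    and Tadd: "\<And>a a' b b'. (a, a') \<in> T \<Longrightarrow> (b, b') \<in> T \<Longrightarrow> (a + b, a' + b') \<in> T"
    and Tscale: "\<And>c a a'. (a, a') \<in> T \<Longrightarrow> (c *s a, c *s a') \<in> T"
    and sub: "subspace U'" "subspace N'" "N' \<subseteq> U'"
    and onto: "\<And>u'. u' \<in> U' \<Longrightarrow> \<exists>u\<in>U. (u, u') \<in> T"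
    and total: "\<And>u. u \<in> U \<Longrightarrow> \<exists>u'\<in>U'. (u, u') \<in> T"
    and onto0: "\<And>u'. u' \<in> N' \<Longrightarrow> \<exists>u\<in>N. (u, u') \<in> T"
    and total0: "\<And>u. u \<in> N \<Longrightarrow> \<exists>u'\<in>N'. (u, u') \<in> T"
    and ker: "\<And>u. u \<in> U \<Longrightarrow> (u, 0) \<in> T \<Longrightarrow> u \<in> N"
    and ker': "\<And>u'. u' \<in> U' \<Longrightarrow> (0, u') \<in> T \<Longrightarrow> u' \<in> N'"
    and N: "subspace U" "subspace N" "N \<subseteq> U" and C: "direct_sum2 scale U N C"
  shows "\<exists>C'. direct_sum2 scale U' N' C' \<and>
    (\<forall>c\<in>C. \<exists>!c'. c' \<in> C' \<and> (c, c') \<in> T) \<and> (\<forall>c'\<in>C'. \<exists>!c. c \<in> C \<and> (c, c') \<in> T)"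
proof -
  have Tdiff: "(a - b, a' - b') \<in> T" if "(a, a') \<in> T" "(b, b') \<in> T" for a a' b b'
    using Tadd[OF that(1) Tscale[OF that(2), of "- 1"]] by simp
  have subC: "subspace C" and sumC: "N + C = U" and intC: "N \<inter> C = {0}"
    using C unfolding direct_sum2_def by auto
  have CU: "C \<subseteq> U" using sumC subspace_0[OF N(2)] by (metis set_plus_intro add_0 subsetI)
  \<comment> \<open>\<open>P\<close> is the image of \<open>C\<close> in \<open>U'\<close> and
    \<open>K\<close> the indeterminacy. Since \<open>P \<inter> N' = K\<close> and
    \<open>N' + P = U'\<close>, a complement of \<open>K\<close> in \<open>P\<close> is also one of
    \<open>N'\<close> in \<open>U'\<close>.\<close>
  define P where "P = {u'\<in>U'. \<exists>c\<in>C. (c, u') \<in> T}"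
  define K where "K = {u'\<in>U'. (0, u') \<in> T}"
  have subP: "subspace P"
  proof (rule subspaceI)
    show "0 \<in> P" using T0 sub subC subspace_0 unfolding P_def by blast
    show "x + y \<in> P" if "x \<in> P" "y \<in> P" for x y
      using that Tadd subspace_add[OF sub(1)] subspace_add[OF subC] unfolding P_def by blast
    show "c *s x \<in> P" if "x \<in> P" for c x
      using that Tscale subspace_scale[OF sub(1)] subspace_scale[OF subC] unfolding P_def by blast
  qed
  have subK: "subspace K"
  proof (rule subspaceI)
    show "0 \<in> K" using T0 sub subspace_0 unfolding K_def by blast
    show "x + y \<in> K" if "x \<in> K" "y \<in> K" for x y
      using that Tadd[of 0 x 0 y] subspace_add[OF sub(1)] unfolding K_def by auto
    show "c *s x \<in> K" if "x \<in> K" for c x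
      using that Tscale[of 0 x c] subspace_scale[OF sub(1)] unfolding K_def by auto
  qed
  have KP: "K \<subseteq> P" unfolding K_def P_def using subspace_0[OF subC] by blast
  have KU0: "K \<subseteq> N'" unfolding K_def using ker' by blast
  have PU0: "P \<inter> N' \<subseteq> K"
  proof
    fix u' assume u': "u' \<in> P \<inter> N'"
    then obtain c u where c: "c \<in> C" "(c, u') \<in> T" "u \<in> N" "(u, u') \<in> T"
      using onto0 unfolding P_def by blast
    \<comment> \<open>\<open>c - u\<close> is related to \<open>0\<close>, hence in
      \<open>N\<close>; as \<open>u\<close> is in \<open>N\<close>, so is \<open>c\<close>, and
      \<open>N \<inter> C = {0}\<close> leaves \<open>c = 0\<close>.\<close>
    then have "(c - u, 0) \<in> T" using Tdiff[of c u' u u'] by simp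
    then have "c - u \<in> N" using ker c CU N subspace_diff[OF N(1)] by blast
    then have "c \<in> N" using subspace_add[OF N(2), of "c - u" u] c by simp
    then have "c = 0" using c intC by blast
    then show "u' \<in> K" using u' c sub(3) unfolding K_def by blast
  qed
  obtain C' where C': "direct_sum2 scale P K C'" using complement_exists[OF subK subP KP] by blast
  then have subC': "subspace C'" and sumC': "K + C' = P" and intC': "K \<inter> C' = {0}"
    unfolding direct_sum2_def by auto
  have C'P: "C' \<subseteq> P" using sumC' subspace_0[OF subK] by (metis set_plus_intro add_0 subsetI)
  have PU': "P \<subseteq> U'" unfolding P_def by blast
  have "N' + C' = U'"
  proof (intro equalityI subsetI)
    fix x assume "x \<in> N' + C'"
    then obtain a b where "a \<in> N'" "b \<in> C'" "x = a + b" by (rule set_plus_elim)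
    then show "x \<in> U'" using sub(3) C'P PU' subspace_add[OF sub(1), of a b] by blast
  next
    fix x assume x: "x \<in> U'"
    \<comment> \<open>Split a preimage of \<open>x\<close> along \<open>N + C\<close> and subtract a
      partner of the \<open>N\<close> part that lies in \<open>N'\<close>; what remains is in
      \<open>P\<close>.\<close>
    obtain u where u: "u \<in> U" "(u, x) \<in> T" using onto[OF x] by blast
    obtain u0 c where uc: "u0 \<in> N" "c \<in> C" "u = u0 + c"
      using u(1) sumC by (metis set_plus_elim)
    obtain x0 where x0: "x0 \<in> N'" "(u0, x0) \<in> T" using total0 uc by blast
    have "(c, x - x0) \<in> T" using Tdiff[OF u(2) x0(2)] uc by simp
    then have "x - x0 \<in> P" unfolding P_def using uc x x0 sub subspace_diff by blast
    then obtain k c' where k: "k \<in> K" "c' \<in> C'" "x - x0 = k + c'" using sumC' by (metis set_plus_elim)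
    then have "x = (x0 + k) + c'" by (simp add: algebra_simps)
    moreover have "x0 + k \<in> N'" using x0 k KU0 subspace_add[OF sub(2)] by blast
    ultimately show "x \<in> N' + C'" using k by blast
  qed
  moreover have "N' \<inter> C' = {0}"
  proof -
    have "N' \<inter> C' \<subseteq> K \<inter> C'" using PU0 C'P by blast
    then show ?thesis using intC' subspace_0[OF sub(2)] subspace_0[OF subC'] by blast
  qed
  moreover have "\<exists>!c'. c' \<in> C' \<and> (c, c') \<in> T" if c: "c \<in> C" for c
  proof (rule ex_ex1I)
    obtain u' where u': "u' \<in> U'" "(c, u') \<in> T" using total c CU by blast
    then have "u' \<in> P" using c unfolding P_def by blast
    \<comment> \<open>A partner of \<open>c\<close> remains one after its \<open>K\<close>
      component, which is related to \<open>0\<close>, is removed.\<close>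
    then obtain k c' where k: "k \<in> K" "c' \<in> C'" "u' = k + c'" using sumC' by (metis set_plus_elim)
    then have "(c, c') \<in> T" using Tdiff[OF u'(2), of 0 k] unfolding K_def by simp
    then show "\<exists>c'. c' \<in> C' \<and> (c, c') \<in> T" using k by blast
    fix x y assume "x \<in> C' \<and> (c, x) \<in> T" "y \<in> C' \<and> (c, y) \<in> T"
    then have xy: "x \<in> C'" "y \<in> C'" "(0, x - y) \<in> T" using Tdiff[of c x c y] by auto
    then have "x - y \<in> C'" using subspace_diff[OF subC'] by blast
    moreover then have "x - y \<in> K" using xy C'P PU' unfolding K_def by blast
    ultimately have "x - y \<in> K \<inter> C'" by blast
    then show "x = y" unfolding intC' by simp
  qed
  moreover have "\<exists>!c. c \<in> C \<and> (c, c') \<in> T" if c': "c' \<in> C'" for c'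
  proof (rule ex_ex1I)
    show "\<exists>c. c \<in> C \<and> (c, c') \<in> T" using c' C'P unfolding P_def by blast
    fix x y assume "x \<in> C \<and> (x, c') \<in> T" "y \<in> C \<and> (y, c') \<in> T"
    then have xy: "x \<in> C" "y \<in> C" "(x - y, 0) \<in> T" using Tdiff[of x c' y c'] by auto
    then have "x - y \<in> C" using subspace_diff[OF subC] by blast
    moreover then have "x - y \<in> N" using ker xy CU by blast
    ultimately have "x - y \<in> N \<inter> C" by blast
    then show "x = y" unfolding intC by simp
  qed
  ultimately show ?thesis unfolding direct_sum2_def using sub(2) subC'
    by (intro exI[of _ C']) simp
qed

end

section \<open>The filtration of a chain of linear relations\<close>

fun up :: "idx \<Rightarrow> idx" where
  "up (Idx_m i) = Idx_m (i + 1)"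
| "up (Idx_n k) = Idx_n (k + 1)"

lemma idx_cases:
  obtains (m) j where "p = Idx_m j" | (n) j where "p = Idx_n (enat j)" | (inf) "p = Idx_n \<infinity>"
proof (cases p)
  case (Idx_n k)
  then show ?thesis using that by (cases k) simp_all
qed (use that in simp)

lemma up_le_up [simp]: "up p \<le> up q \<longleftrightarrow> p \<le> q"
  by (cases p rule: idx_cases; cases q rule: idx_cases) (auto simp: one_enat_def)

lemma up_inj [simp]: "up p = up q \<longleftrightarrow> p = q"
  by (simp add: order_eq_iff)

lemma idx_up_cases:
  obtains "p = Idx_m 0" | "p = Idx_n 0" | p' where "p = up p'"
proof (cases p rule: idx_cases)
  case (m j)
  then show ?thesis using that(1) that(3)[of "Idx_m (j - 1)"] by (cases j) auto
next
  case (n j)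
  then show ?thesis using that(2) that(3)[of "Idx_n (enat (j - 1))"]
    by (cases j) (auto simp: one_enat_def zero_enat_def)
next
  case inf
  then show ?thesis using that(3)[of "Idx_n \<infinity>"] by simp
qed

text \<open>The top index \<open>Idx_n 0\<close> is never at most a shift. So the indices under a
  shift are shifts again, apart from \<open>Idx_m 0\<close>, where the filtrations vanish.\<close>

lemma le_upE:
  assumes "p \<le> up q"
  obtains "p = Idx_m 0" | p' where "p = up p'" "p' \<le> q"
proof (cases p rule: idx_up_cases)
  assume "p = Idx_n 0"
  then show ?thesis using assms by (cases q rule: idx_cases) (auto simp: one_enat_def zero_enat_def)
qed (use assms that in auto)

lemma m0_le [simp]: "Idx_m 0 \<le> p"
  by (cases p) auto

lemma le_n0 [simp]: "p \<le> Idx_n 0"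
  by (cases p) auto

text \<open>The filtrations \<open>L\<close> and, after the reflection \<open>l \<mapsto> -l\<close>, \<open>R\<close> are instances of one construction,
  in which the maps of the representation only enter through their graphs \<open>T l\<close>.\<close>

locale relation_chain = vector_space scale
  for scale :: "'a::field \<Rightarrow> 'b::ab_group_add \<Rightarrow> 'b" +
  fixes V :: "int \<Rightarrow> 'b set" and T :: "int \<Rightarrow> ('b \<times> 'b) set" and G :: "int \<Rightarrow> idx \<Rightarrow> 'b set"
  assumes subspace_V: "subspace (V l)"
    and fin_dim: "\<exists>B. finite B \<and> V l = span B"
    and T_in: "T l \<subseteq> V l \<times> V (l + 1)"
    and T_0: "(0, 0) \<in> T l"
    and T_add: "(v, v') \<in> T l \<Longrightarrow> (w, w') \<in> T l \<Longrightarrow> (v + w, v' + w') \<in> T l"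
    and T_scale: "(v, v') \<in> T l \<Longrightarrow> (scale c v, scale c v') \<in> T l"
    and G_m0: "G l (Idx_m 0) = {0}"
    and G_n0: "G l (Idx_n 0) = V l"
    and G_up_m: "G (l + 1) (Idx_m (j + 1)) = T l `` G l (Idx_m j)"
    and G_up_n: "G (l + 1) (Idx_n (enat (j + 1))) = T l `` G l (Idx_n (enat j))"
    and G_inf: "G l (Idx_n \<infinity>) =
      {v \<in> V l. \<exists>w. w 0 = v \<and> (\<forall>i. (w (Suc i), w i) \<in> T (l - int i - 1))}"
begin

section \<open>Linearity and monotonicity of the filtration, and its value at infinity\<close>

lemma subspace_Image:
  assumes "subspace A" shows "subspace (T l `` A)"
proof (rule subspaceI)
  show "0 \<in> T l `` A" using T_0 subspace_0[OF assms] by blast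
  show "x + y \<in> T l `` A" if "x \<in> T l `` A" "y \<in> T l `` A" for x y
    using that T_add subspace_add[OF assms] by blast
  show "scale c x \<in> T l `` A" if "x \<in> T l `` A" for c x
    using that T_scale subspace_scale[OF assms] by blast
qed

lemma G_Suc_m: "G l (Idx_m (Suc j)) = T (l - 1) `` G (l - 1) (Idx_m j)"
  using G_up_m[of "l - 1" j] by simp

lemma G_Suc_n: "G l (Idx_n (enat (Suc j))) = T (l - 1) `` G (l - 1) (Idx_n (enat j))"
  using G_up_n[of "l - 1" j] by simp

lemma G_enat0: "G l (Idx_n (enat 0)) = V l"
  using G_n0 by (simp add: zero_enat_def)

lemma T_range: "T (l - 1) `` A \<subseteq> V l"
  using T_in[of "l - 1"] by auto

lemma subspace_G_m: "subspace (G l (Idx_m j))"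
  by (induction j arbitrary: l) (simp_all add: G_m0 G_Suc_m subspace_Image)

lemma subspace_G_n: "subspace (G l (Idx_n (enat j)))"
  by (induction j arbitrary: l) (simp_all add: G_enat0 G_Suc_n subspace_Image subspace_V)

lemma G_n_in_V: "G l (Idx_n (enat j)) \<subseteq> V l"
  by (cases j) (simp_all add: G_enat0 G_Suc_n T_range)

lemma G_m_Suc: "G l (Idx_m j) \<subseteq> G l (Idx_m (Suc j))"
proof (induction j arbitrary: l)
  case 0
  show ?case using subspace_0[OF subspace_G_m] by (simp add: G_m0)
next
  case (Suc j)
  show ?case unfolding G_Suc_m[of l] using Suc.IH[of "l - 1"] by (rule Image_mono[OF subset_refl])
qed

lemma G_n_Suc: "G l (Idx_n (enat (Suc j))) \<subseteq> G l (Idx_n (enat j))"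
proof (induction j arbitrary: l)
  case 0
  show ?case by (simp add: G_enat0 G_n_in_V)
next
  case (Suc j)
  show ?case unfolding G_Suc_n[of l] using Suc.IH[of "l - 1"] by (rule Image_mono[OF subset_refl])
qed

lemma G_m_mono: "i \<le> j \<Longrightarrow> G l (Idx_m i) \<subseteq> G l (Idx_m j)"
  by (rule lift_Suc_mono_le[of "\<lambda>j. G l (Idx_m j)"]) (simp_all add: G_m_Suc)

lemma G_n_mono: "i \<le> j \<Longrightarrow> G l (Idx_n (enat j)) \<subseteq> G l (Idx_n (enat i))"
  by (rule lift_Suc_antimono_le[of "\<lambda>j. G l (Idx_n (enat j))"]) (simp_all add: G_n_Suc)

text \<open>At equal subscripts both sides are transports, of \<open>{0}\<close> and of the whole
  space, along the same path; different subscripts are compared at their maximum.\<close>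

lemma G_m_subset_n: "G l (Idx_m j) \<subseteq> G l (Idx_n (enat i))"
proof -
  have *: "G l (Idx_m j) \<subseteq> G l (Idx_n (enat j))" for j
  proof (induction j arbitrary: l)
    case 0
    show ?case using subspace_0[OF subspace_V] by (simp add: G_m0 G_enat0)
  next
    case (Suc j)
    show ?case unfolding G_Suc_m G_Suc_n using Suc.IH by (rule Image_mono[OF subset_refl])
  qed
  have "G l (Idx_m j) \<subseteq> G l (Idx_m (max i j))" by (rule G_m_mono) simp
  also have "\<dots> \<subseteq> G l (Idx_n (enat (max i j)))" by (rule *)
  also have "\<dots> \<subseteq> G l (Idx_n (enat i))" by (rule G_n_mono) simp
  finally show ?thesis .
qed

text \<open>A decreasing sequence of subspaces of a finite-dimensional space is constant from a term
  of least dimension on.\<close>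

lemma G_n_stable: "\<exists>K. \<forall>k\<ge>K. G l (Idx_n (enat k)) = G l (Idx_n (enat K))"
proof -
  let ?G = "\<lambda>k. G l (Idx_n (enat k))"
  obtain B where B: "finite B" "V l = span B" using fin_dim by blast
  obtain K where K: "\<And>k. dim (?G K) \<le> dim (?G k)"
    using ex_has_least_nat[of "\<lambda>_. True" 0 "\<lambda>k. dim (?G k)"] by auto
  have "?G k = ?G K" if "k \<ge> K" for k
  proof (rule ccontr)
    assume "?G k \<noteq> ?G K"
    then have "?G k \<subset> ?G K" using G_n_mono[OF that] by auto
    then have "dim (?G k) < dim (?G K)"
      using B G_n_in_V by (intro dim_strict_mono[OF subspace_G_n]) auto
    then show False using K[of k] by simp
  qed
  then show ?thesis by blast
qed

text \<open>A Mittag-Leffler argument: the eventual values of the sequences \<open>k \<mapsto> G l (n\<^sub>-\<^sub>k)\<close> are mapped onto each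
  other by the relations \<open>T l\<close>, so that strands can be built step by step.\<close>

lemma G_n_eq_inf: "\<exists>K. \<forall>k\<ge>K. G l (Idx_n (enat k)) = G l (Idx_n \<infinity>)"
proof -
  have "\<forall>l. \<exists>K. \<forall>k\<ge>K. G l (Idx_n (enat k)) = G l (Idx_n (enat K))" using G_n_stable by blast
  then obtain K where K: "\<And>l k. k \<ge> K l \<Longrightarrow> G l (Idx_n (enat k)) = G l (Idx_n (enat (K l)))"
    by metis
  define S where "S l = G l (Idx_n (enat (K l)))" for l
  have S_step: "S l = T (l - 1) `` S (l - 1)" for l
  proof -
    \<comment> \<open>From \<open>?k\<close> on the sequences at \<open>l\<close> and at
      \<open>l - 1\<close> have both settled, so one application of \<open>G_Suc_n\<close> relates
      their eventual values.\<close>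
    let ?k = "max (K l) (K (l - 1))"
    have "S l = G l (Idx_n (enat (Suc ?k)))" unfolding S_def by (rule K[symmetric]) simp
    also have "\<dots> = T (l - 1) `` S (l - 1)" using K[of "l - 1" ?k] by (simp add: G_Suc_n S_def)
    finally show ?thesis .
  qed
  have "S l \<subseteq> G l (Idx_n \<infinity>)"
  proof
    fix v assume v: "v \<in> S l"
    \<comment> \<open>Dependent choice walks left through the eventual values; the clause for
      \<open>i = 0\<close> pins the starting vector.\<close>
    have "\<exists>w. \<forall>i. (w i \<in> S (l - int i) \<and> (i = 0 \<longrightarrow> w i = v)) \<and> (w (Suc i), w i) \<in> T (l - int i - 1)"
    proof (rule dependent_nat_choice)
      show "\<exists>x. x \<in> S (l - int 0) \<and> (0 = 0 \<longrightarrow> x = v)" using v by simp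
      fix x i assume "x \<in> S (l - int i) \<and> (i = 0 \<longrightarrow> x = v)"
      then obtain y where "(y, x) \<in> T (l - int i - 1)" "y \<in> S (l - int i - 1)"
        using S_step by blast
      moreover have "l - int i - 1 = l - int (Suc i)" by simp
      ultimately show "\<exists>y. (y \<in> S (l - int (Suc i)) \<and> (Suc i = 0 \<longrightarrow> y = v)) \<and>
          (y, x) \<in> T (l - int i - 1)" by (metis Suc_neq_Zero)
    qed
    moreover have "v \<in> V l" using v G_n_in_V by (auto simp: S_def)
    ultimately show "v \<in> G l (Idx_n \<infinity>)" unfolding G_inf by blast
  qed
  moreover have "G l (Idx_n \<infinity>) \<subseteq> G l (Idx_n (enat k))" for k
  proof
    fix v assume "v \<in> G l (Idx_n \<infinity>)"
    then obtain w where w: "w 0 = v" "\<And>i. (w (Suc i), w i) \<in> T (l - int i - 1)"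
      and v: "v \<in> V l" unfolding G_inf by blast
    have wV: "w i \<in> V (l - int i)" for i
      using w(2)[of i] T_in[of "l - int i - 1"] by auto
    \<comment> \<open>Stated for all \<open>i\<close>, since lowering the index by one step passes
      to the tail of the strand.\<close>
    have "w i \<in> G (l - int i) (Idx_n (enat j))" for i j
    proof (induction j arbitrary: i)
      case 0
      show ?case by (simp add: G_enat0 wV)
    next
      case (Suc j)
      have "w (Suc i) \<in> G (l - int i - 1) (Idx_n (enat j))"
        using Suc.IH[of "Suc i"] by (simp add: algebra_simps)
      then show ?case unfolding G_Suc_n using w(2)[of i] by blast
    qed
    from this[of 0] show "v \<in> G l (Idx_n (enat k))" using w(1) by simp
  qed
  ultimately have "\<forall>k\<ge>K l. G l (Idx_n (enat k)) = G l (Idx_n \<infinity>)"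
    unfolding S_def using K by blast
  then show ?thesis by blast
qed

text \<open>At \<open>Idx_n \<infinity>\<close> both filtrations take the value of a common large
  finite subscript, which reduces this case to \<open>G_up_n\<close>.\<close>

lemma G_up: "G (l + 1) (up p) = T l `` G l p"
proof (cases p rule: idx_cases)
  case inf
  obtain K K' where "\<forall>k\<ge>K. G l (Idx_n (enat k)) = G l (Idx_n \<infinity>)"
    and "\<forall>k\<ge>K'. G (l + 1) (Idx_n (enat k)) = G (l + 1) (Idx_n \<infinity>)"
    using G_n_eq_inf by metis
  then have "G l (Idx_n (enat (max K K'))) = G l (Idx_n \<infinity>)"
    and "G (l + 1) (Idx_n (enat (max K K' + 1))) = G (l + 1) (Idx_n \<infinity>)" by auto
  then show ?thesis using G_up_n[of l "max K K'"] inf by simp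
qed (use G_up_m G_up_n in \<open>simp_all add: one_enat_def\<close>)

lemma subspace_G: "subspace (G l p)"
proof (cases p rule: idx_cases)
  case inf
  then show ?thesis using G_n_eq_inf[of l] subspace_G_n by (metis order_refl)
qed (simp_all add: subspace_G_m subspace_G_n)

lemma G_mono: "p \<le> q \<Longrightarrow> G l p \<subseteq> G l q"
proof -
  assume pq: "p \<le> q"
  obtain K where K: "\<And>k. k \<ge> K \<Longrightarrow> G l (Idx_n (enat k)) = G l (Idx_n \<infinity>)"
    using G_n_eq_inf by blast
  have "G l (Idx_n \<infinity>) \<subseteq> G l (Idx_n (enat j))" for j
    using K[of "max K j"] G_n_mono[of j "max K j" l] by simp
  moreover have "G l (Idx_m j) \<subseteq> G l (Idx_n \<infinity>)" for j
    using K[of K] G_m_subset_n[of l j K] by simp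
  ultimately show ?thesis using pq G_m_mono G_n_mono G_m_subset_n
    by (cases p rule: idx_cases; cases q rule: idx_cases) auto
qed

lemma mono_G: "mono (G l)"
  using G_mono by (rule monoI)

lemma G_in_V: "G l p \<subseteq> V l"
  using G_mono[OF le_n0] by (simp add: G_n0)

text \<open>The index order has infinite descending sequences, so the least index is found by cases:
  among the \<open>Idx_m j\<close> by well-ordering, then at \<open>Idx_n \<infinity>\<close>, and
  otherwise among finitely many finite subscripts of \<open>Idx_n\<close>.\<close>

lemma G_least: "\<exists>p0. G l p0 = G l p \<and> (\<forall>p'<p0. G l p' \<noteq> G l p)"
proof (cases "\<exists>j. G l (Idx_m j) = G l p")
  case True
  define j where "j = (LEAST j. G l (Idx_m j) = G l p)"
  have "G l (Idx_m j) = G l p" unfolding j_def using True by (rule LeastI_ex)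
  moreover have "G l p' \<noteq> G l p" if "p' < Idx_m j" for p'
  proof (cases p')
    case (Idx_m i)
    then have "i < j" using that by (simp add: less_le_not_le)
    then show ?thesis unfolding j_def Idx_m by (rule not_less_Least)
  qed (use that in \<open>simp add: less_le_not_le\<close>)
  ultimately show ?thesis by blast
next
  case no_m: False
  show ?thesis
  proof (cases "G l (Idx_n \<infinity>) = G l p")
    case True
    moreover have "G l p' \<noteq> G l p" if "p' < Idx_n \<infinity>" for p'
      using that no_m by (cases p') (auto simp: less_le_not_le)
    ultimately show ?thesis by blast
  next
    case no_inf: False
    obtain K where K: "\<And>k. k \<ge> K \<Longrightarrow> G l (Idx_n (enat k)) = G l (Idx_n \<infinity>)"
      using G_n_eq_inf by blast
    \<comment> \<open>Stabilization bounds \<open>A\<close>. Its maximum gives the smallest index,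
      because the order on the subscripts of \<open>Idx_n\<close> is reversed.\<close>
    define A where "A = {k. G l (Idx_n (enat k)) = G l p}"
    have "A \<subseteq> {..<K}" using K no_inf
      by (metis (mono_tags, lifting) A_def lessThan_iff linorder_le_less_linear mem_Collect_eq subsetI)
    then have fA: "finite A" using finite_subset by blast
    have "A \<noteq> {}" using no_m no_inf by (cases p rule: idx_cases) (auto simp: A_def)
    then have "Max A \<in> A" using fA by simp
    then have "G l (Idx_n (enat (Max A))) = G l p" by (simp add: A_def)
    moreover have "G l p' \<noteq> G l p" if "p' < Idx_n (enat (Max A))" for p'
    proof
      assume eq: "G l p' = G l p"
      then obtain k where "p' = Idx_n (enat k)" using no_m no_inf by (cases p' rule: idx_cases) auto
      then have "k \<in> A" "Max A < k" using eq that by (auto simp: A_def less_le_not_le)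
      then show False using Max_ge[OF fA] by fastforce
    qed
    ultimately show ?thesis by blast
  qed
qed

end

section \<open>Compatible families\<close>

text \<open>The summands at the index \<open>m\<^sub>0\<close> are zero and belong to no \<open>E\<^sub>s\<^sub>,\<^sub>t\<close>.\<close>

definition proper :: "(idx \<times> idx) set" where
  "proper = {(p, q). p \<noteq> Idx_m 0 \<and> q \<noteq> Idx_m 0}"

lemma properI [intro]: "p \<noteq> Idx_m 0 \<Longrightarrow> q \<noteq> Idx_m 0 \<Longrightarrow> (p, q) \<in> proper"
  by (simp add: proper_def)

text \<open>\<open>C\<^sup>l\<close> at the index \<open>(p, q)\<close> is a summand of \<open>E\<^sub>s\<^sub>,\<^sub>t\<close> for \<open>s = lpar l p\<close> and \<open>t = rpar l q\<close>.\<close>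

fun lpar :: "int \<Rightarrow> idx \<Rightarrow> int extended" where
  "lpar l (Idx_m i) = Fin (l + 1 - int i)"
| "lpar l (Idx_n (enat k)) = Fin (l - int k)"
| "lpar l (Idx_n \<infinity>) = Minf"

fun rpar :: "int \<Rightarrow> idx \<Rightarrow> int extended" where
  "rpar l (Idx_m j) = Fin (l - 1 + int j)"
| "rpar l (Idx_n (enat k)) = Fin (l + int k)"
| "rpar l (Idx_n \<infinity>) = Pinf"

definition params :: "int \<Rightarrow> idx \<times> idx \<Rightarrow> int extended \<times> int extended" where
  "params l = (\<lambda>(p, q). (lpar l p, rpar l q))"

text \<open>Together with \<open>rpar_up\<close>: \<open>(p, up q)\<close> at \<open>l\<close> and
  \<open>(up p, q)\<close> at \<open>l + 1\<close> carry the same interval, which is why arrows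
  respect the \<open>E\<close>.\<close>

lemma lpar_up [simp]: "lpar (l + 1) (up p) = lpar l p"
  by (cases p rule: idx_cases) (auto simp: one_enat_def)

lemma rpar_up [simp]: "rpar l (up q) = rpar (l + 1) q"
  by (cases q rule: idx_cases) (auto simp: one_enat_def)

text \<open>Away from \<open>Idx_m 0\<close> the left end is at most \<open>l\<close> and the right
  end at least \<open>l\<close>.\<close>

lemma params_in: "r \<in> proper \<Longrightarrow> params l r \<in> parameters"
proof -
  assume r: "r \<in> proper"
  obtain p q where pq: "r = (p, q)" by (cases r)
  show ?thesis using r unfolding pq proper_def params_def parameters_def
    by (cases p rule: idx_cases; cases q rule: idx_cases) auto
qed

text \<open>A finite end comes from one \<open>Idx_m\<close> and one \<open>Idx_n\<close>; this is
  the source of the four summands of \<open>E\<close> for a finite interval.\<close>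

lemma lpar_eq_Fin: "{p. p \<noteq> Idx_m 0 \<and> lpar l p = Fin s} =
    (if s \<le> l then {m_ix (1 + l - s), n_ix (s - l)} else {})" (is "?A = ?B")
proof (rule set_eqI)
  show "p \<in> ?A \<longleftrightarrow> p \<in> ?B" for p by (cases p rule: idx_cases) auto
qed

lemma rpar_eq_Fin: "{q. q \<noteq> Idx_m 0 \<and> rpar l q = Fin t} =
    (if l \<le> t then {m_ix (1 + t - l), n_ix (l - t)} else {})" (is "?A = ?B")
proof (rule set_eqI)
  show "q \<in> ?A \<longleftrightarrow> q \<in> ?B" for q by (cases q rule: idx_cases) auto
qed

lemma lpar_eq_Minf: "{p. p \<noteq> Idx_m 0 \<and> lpar l p = Minf} = {n_minf}" (is "?A = ?B")
proof (rule set_eqI)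
  show "p \<in> ?A \<longleftrightarrow> p \<in> ?B" for p by (cases p rule: idx_cases) auto
qed

lemma rpar_eq_Pinf: "{q. q \<noteq> Idx_m 0 \<and> rpar l q = Pinf} = {n_minf}" (is "?A = ?B")
proof (rule set_eqI)
  show "q \<in> ?A \<longleftrightarrow> q \<in> ?B" for q by (cases q rule: idx_cases) auto
qed

text \<open>The fibre of \<open>params\<close> is a product of fibres of \<open>lpar\<close> and
  \<open>rpar\<close>, each of at most two indices. For \<open>l\<close> outside the interval it is
  empty, and its span \<open>{0}\<close> agrees with the default value.\<close>

lemma (in vector_space) E_eq_span:
  assumes st: "(s, t) \<in> parameters" and C: "\<And>r. subspace (C l r)"
  shows "E C s t l = span (\<Union>r\<in>{r\<in>proper. params l r = (s, t)}. C l r)"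
proof -
  have eq: "{r\<in>proper. params l r = (s, t)} =
      {p. p \<noteq> Idx_m 0 \<and> lpar l p = s} \<times> {q. q \<noteq> Idx_m 0 \<and> rpar l q = t}"
    by (auto simp: proper_def params_def)
  have 0: "{0} + {0} = {0::'b}" by (auto simp: set_plus_def)
  have span_C: "span (C l r) = C l r" for r using C by simp
  show ?thesis unfolding eq using st
    by (cases s; cases t)
      (simp_all add: parameters_def lpar_eq_Fin rpar_eq_Fin lpar_eq_Minf rpar_eq_Pinf
        Dmm_def Dmn_def Dnm_def Dnn_def Dmn_pinf_def Dnn_pinf_def Dnm_minf_def Dnn_minf_def
        Dnn_minf_pinf_def span_Un_plus span_C 0 add.assoc)
qed

locale lfd_quiver_rep = quiver_rep +
  assumes lfd: locally_finite_dim
begin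

section \<open>Transport and strands in terms of the graphs of the maps\<close>

definition graph :: "int \<Rightarrow> ('b \<times> 'b) set" where
  "graph l = {(v, w). v \<in> V l \<and> w \<in> V (l + 1) \<and> (if src l = l then f l v = w else f l w = v)}"

lemma src_tgt: "src l = l \<Longrightarrow> tgt l = l + 1" "src l \<noteq> l \<Longrightarrow> src l = l + 1" "src l \<noteq> l \<Longrightarrow> tgt l = l"
  using arrow[of l] by auto

lemma f_0: "f l 0 = 0"
  using f_scale[OF subspace_0[OF subspace_V], of l 0] by simp

lemma graph_add: "(v, v') \<in> graph l \<Longrightarrow> (w, w') \<in> graph l \<Longrightarrow> (v + w, v' + w') \<in> graph l"
  using f_add[of v l w] f_add[of v' l w'] src_tgt[of l]
  by (auto simp: graph_def subspace_add[OF subspace_V] split: if_splits)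

lemma graph_scale: "(v, v') \<in> graph l \<Longrightarrow> (scale c v, scale c v') \<in> graph l"
  using f_scale[of v l c] f_scale[of v' l c] src_tgt[of l]
  by (auto simp: graph_def subspace_scale[OF subspace_V] split: if_splits)

lemma graph_0: "(0, 0) \<in> graph l"
  by (simp add: graph_def f_0 subspace_0[OF subspace_V])

lemma finite_span_V: "\<exists>B. finite B \<and> V l = span B"
  using lfd unfolding locally_finite_dim_def by metis

lemma graph_forward: "src l = l \<Longrightarrow> graph l = {(v, w). v \<in> V l \<and> w = f l v}"
  using f_in[of _ l] src_tgt[of l] by (auto simp: graph_def)

lemma graph_backward: "src l \<noteq> l \<Longrightarrow> graph l = {(v, w). w \<in> V (l + 1) \<and> v = f l w}"
  using f_in[of _ l] src_tgt[of l] by (auto simp: graph_def)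

lemma transport_step_right:
  assumes "A \<subseteq> V l"
  shows "transport_step l (l + 1) A = graph l `` A"
proof (cases "src l = l")
  case True
  then show ?thesis using assms by (auto simp: transport_step_def graph_forward)
next
  case False
  then show ?thesis by (auto simp: transport_step_def graph_backward)
qed

lemma transport_step_left:
  assumes "A \<subseteq> V (l + 1)"
  shows "transport_step (l + 1) l A = (graph l)\<inverse> `` A"
proof (cases "src l = l")
  case True
  then show ?thesis by (auto simp: transport_step_def graph_forward)
next
  case False
  then show ?thesis using assms src_tgt(2)[OF False]
    by (auto simp: transport_step_def graph_backward)
qed

lemma transport_subset:
  assumes "A \<subseteq> V (x 0)" and "\<And>i. i < n \<Longrightarrow> x (Suc i) = x i + 1 \<or> x i = x (Suc i) + 1"
  shows "transport x n A \<subseteq> V (x n)"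
  using assms(2)
proof (induction n)
  case (Suc n)
  then have IH: "transport x n A \<subseteq> V (x n)" by simp
  consider "x (Suc n) = x n + 1" | "x n = x (Suc n) + 1" using Suc.prems by blast
  then show ?case
  proof cases
    case 1
    then show ?thesis using transport_step_right[OF IH] by (auto simp: graph_def)
  next
    case 2
    then show ?thesis using transport_step_left[of "transport x n A" "x (Suc n)"] IH
      by (auto simp: graph_def)
  qed
qed (use assms in simp)

text \<open>Both paths start at \<open>l - int j\<close>; the longer one has arrow \<open>l\<close>
  as its additional last step.\<close>

lemma transport_up_right:
  assumes "A \<subseteq> V (l - int j)"
  shows "transport (\<lambda>i. l + 1 - int (j + 1) + int i) (j + 1) A =
    graph l `` transport (\<lambda>i. l - int j + int i) j A"
  using transport_step_right[of "transport (\<lambda>i. l - int j + int i) j A" l]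
    transport_subset[of A "\<lambda>i. l - int j + int i" j] assms by simp

lemma transport_up_left:
  assumes "A \<subseteq> V (l + 1 + int j)"
  shows "transport (\<lambda>i. l + int (j + 1) - int i) (j + 1) A =
    (graph l)\<inverse> `` transport (\<lambda>i. l + 1 + int j - int i) j A"
  using transport_step_left[of "transport (\<lambda>i. l + 1 + int j - int i) j A" l]
    transport_subset[of A "\<lambda>i. l + 1 + int j - int i" j] assms
  by (simp add: algebra_simps)

text \<open>Walking left reverses the pairs: position \<open>Suc i\<close> of the strand sits at the
  smaller vertex. Membership in the spaces is part of \<open>graph\<close>.\<close>

lemma strand_left_iff:
  "strand (\<lambda>i. l - int i) w \<longleftrightarrow> (\<forall>i. (w (Suc i), w i) \<in> graph (l - int i - 1))"
proof -
  have "(w (Suc i), w i) \<in> graph (l - int i - 1) \<longleftrightarrow>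
      w (Suc i) \<in> V (l - int (Suc i)) \<and> w i \<in> V (l - int i) \<and>
      (let e = min (l - int i) (l - int (Suc i)) in
        if src e = l - int i then f e (w i) = w (Suc i) else f e (w (Suc i)) = w i)" for i
  proof -
    define e where "e = l - int i - 1"
    have e: "l - int i = e + 1" "l - int (Suc i) = e" "l - int i - 1 = e" by (simp_all add: e_def)
    show ?thesis unfolding e using arrow[of e] by (auto simp: graph_def)
  qed
  then show ?thesis unfolding strand_def by blast
qed

lemma strand_right_iff:
  "strand (\<lambda>i. l + int i) w \<longleftrightarrow> (\<forall>i. (w i, w (Suc i)) \<in> graph (l + int i))"
proof -
  have "(w i, w (Suc i)) \<in> graph (l + int i) \<longleftrightarrow>
      w i \<in> V (l + int i) \<and> w (Suc i) \<in> V (l + int (Suc i)) \<and>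
      (let e = min (l + int i) (l + int (Suc i)) in
        if src e = l + int i then f e (w i) = w (Suc i) else f e (w (Suc i)) = w i)" for i
  proof -
    define e where "e = l + int i"
    have e: "l + int (Suc i) = e + 1" "l + int i = e" by (simp_all add: e_def)
    show ?thesis unfolding e by (auto simp: graph_def)
  qed
  then show ?thesis unfolding strand_def by blast
qed

section \<open>The filtrations \<open>L\<close> and \<open>R\<close> as relation chains\<close>

sublocale left: relation_chain scale V graph L
proof
  fix l j
  show "L l (Idx_n 0) = V l" using L.simps(2)[of l 0] by (simp add: zero_enat_def)
  show "L (l + 1) (Idx_m (j + 1)) = graph l `` L l (Idx_m j)"
    unfolding L.simps using subspace_0[OF subspace_V] by (intro transport_up_right) simp
  show "L (l + 1) (Idx_n (enat (j + 1))) = graph l `` L l (Idx_n (enat j))"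
    using transport_up_right[of "V (l - int j)" l j] by simp
  show "L l n_minf = {v \<in> V l. \<exists>w. w 0 = v \<and> (\<forall>i. (w (Suc i), w i) \<in> graph (l - int i - 1))}"
    unfolding L.simps strand_left_iff by blast
qed (auto simp: graph_add graph_scale graph_0 subspace_V finite_span_V, auto simp: graph_def)

text \<open>After reflection, step \<open>l\<close> joins \<open>- l\<close> to
  \<open>- l - 1\<close>. It is arrow \<open>- l - 1\<close> of the quiver read from its right end
  to its left end, hence the converse.\<close>

sublocale right: relation_chain scale "\<lambda>l. V (- l)" "\<lambda>l. (graph (- l - 1))\<inverse>" "\<lambda>l. R (- l)"
proof
  fix l j
  show "R (- l) (Idx_n 0) = V (- l)" using R.simps(2)[of "- l" 0] by (simp add: zero_enat_def)
  show "R (- (l + 1)) (Idx_m (j + 1)) = (graph (- l - 1))\<inverse> `` R (- l) (Idx_m j)"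
    using transport_up_left[of "{0}" "- l - 1" j] subspace_0[OF subspace_V] by simp
  show "R (- (l + 1)) (Idx_n (enat (j + 1))) = (graph (- l - 1))\<inverse> `` R (- l) (Idx_n (enat j))"
    using transport_up_left[of "V (- l + int j)" "- l - 1" j] by simp
  have "- l + int i = - (l - int i - 1) - 1" for i by simp
  then show "R (- l) n_minf = {v \<in> V (- l). \<exists>w. w 0 = v \<and>
      (\<forall>i. (w (Suc i), w i) \<in> (graph (- (l - int i - 1) - 1))\<inverse>)}"
    unfolding R.simps strand_right_iff by auto
qed (auto simp: graph_add graph_scale graph_0 subspace_V finite_span_V, auto simp: graph_def)

lemma L_up: "L (l + 1) (up p) = graph l `` L l p"
  by (rule left.G_up)

lemma R_up: "R l (up q) = (graph l)\<inverse> `` R (l + 1) q"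
  using right.G_up[of "- l - 1" q] by (simp add: add.commute)

lemma R_facts:
  shows subspace_R: "subspace (R l q)" and mono_R: "mono (R l)" and R_in_V: "R l q \<subseteq> V l"
    and R_m0: "R l (Idx_m 0) = {0}" and R_n0: "R l (Idx_n 0) = V l"
    and R_least: "\<exists>q0. R l q0 = R l q \<and> (\<forall>q'<q0. R l q' \<noteq> R l q)"
  using right.subspace_G[of "- l" q] right.mono_G[of "- l"] right.G_in_V[of "- l" q]
    right.G_m0[of "- l"] right.G_n0[of "- l"] right.G_least[of "- l" q] by simp_all

section \<open>Matching the steps of \<open>LR\<close> along an arrow\<close>

lemma subspace_LR: "subspace (LR l r)"
  by (cases r) (simp add: LR_def subspace_inter left.subspace_G subspace_R)

lemma mono_LR: "mono (LR l)"
  using monoD[OF left.mono_G] monoD[OF mono_R] by (fastforce intro!: monoI simp: LR_def)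

lemma LR_in_V: "LR l r \<subseteq> V l"
  using R_in_V by (cases r) (auto simp: LR_def)

lemma LR_m0: "r \<notin> proper \<Longrightarrow> LR l r = {0}"
  using left.G_m0 R_m0 subspace_0[OF left.subspace_G] subspace_0[OF subspace_R]
  by (cases r) (auto simp: LR_def proper_def)

text \<open>A partner of \<open>u\<close> in the \<open>R\<close> space exists because
  \<open>R l (up q)\<close> is a preimage; it lies in the \<open>L\<close> space because
  \<open>L (l + 1) (up p)\<close> is an image.\<close>

lemma LR_total: "u \<in> LR l (p, up q) \<Longrightarrow> \<exists>u'\<in>LR (l + 1) (up p, q). (u, u') \<in> graph l"
  by (auto simp: LR_def L_up R_up)

lemma LR_onto: "u' \<in> LR (l + 1) (up p, q) \<Longrightarrow> \<exists>u\<in>LR l (p, up q). (u, u') \<in> graph l"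
  by (auto simp: LR_def L_up R_up)

text \<open>Induction over \<open>below\<close> using proper indices only, as the others contribute
  just zero. Scalars are absorbed because each \<open>LR l r'\<close> is a subspace.\<close>

lemma below_induct [consumes 1, case_names zero base add]:
  assumes "u \<in> below scale (LR l) r" and "Q 0"
    and "\<And>r' v. r' < r \<Longrightarrow> r' \<in> proper \<Longrightarrow> v \<in> LR l r' \<Longrightarrow> Q v"
    and "\<And>v w. Q v \<Longrightarrow> Q w \<Longrightarrow> Q (v + w)"
  shows "Q u"
  using assms(1) unfolding below_def
proof (induction rule: span_induct_alt)
  case (step c x y)
  then obtain r' where r': "r' < r" "x \<in> LR l r'" by blast
  have "Q (scale c x)"
  proof (cases "r' \<in> proper")
    case True
    then show ?thesis using r' subspace_scale[OF subspace_LR] assms(3) by blast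
  next
    case False
    then show ?thesis using r' LR_m0 assms(2) by auto
  qed
  then show ?case using step assms(4) by blast
qed (rule assms(2))

text \<open>A proper index below \<open>(p, up q)\<close> has the form \<open>(a, up q')\<close>,
  and \<open>(up a, q')\<close> is below \<open>(up p, q)\<close>; so generators have partners in
  \<open>below\<close>.\<close>

lemma below_total:
  assumes "u \<in> below scale (LR l) (p, up q)"
  shows "\<exists>u'\<in>below scale (LR (l + 1)) (up p, q). (u, u') \<in> graph l"
  using assms
proof (induction rule: below_induct)
  case zero
  show ?case using graph_0 subspace_0[OF subspace_below] by blast
next
  case (base r' v)
  obtain a b where ab: "r' = (a, b)" by (cases r')
  then have "b \<le> up q" "b \<noteq> Idx_m 0" using base by (auto simp: less_le proper_def)
  then obtain q' where q': "b = up q'" "q' \<le> q" using le_upE[of b q] by metis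
  obtain u' where "u' \<in> LR (l + 1) (up a, q')" "(v, u') \<in> graph l"
    using LR_total base ab q' by blast
  moreover have "(up a, q') < (up p, q)" using base(1) by (simp add: ab q' less_le)
  ultimately show ?case using subset_below[of "(up a, q')"] by blast
next
  case (add v w)
  then show ?case using graph_add subspace_add[OF subspace_below] by blast
qed

lemma below_onto:
  assumes "u' \<in> below scale (LR (l + 1)) (up p, q)"
  shows "\<exists>u\<in>below scale (LR l) (p, up q). (u, u') \<in> graph l"
  using assms
proof (induction rule: below_induct)
  case zero
  show ?case using graph_0 subspace_0[OF subspace_below] by blast
next
  case (base r' v)
  obtain a b where ab: "r' = (a, b)" by (cases r')
  then have "a \<le> up p" "a \<noteq> Idx_m 0" using base by (auto simp: less_le proper_def)
  then obtain p' where p': "a = up p'" "p' \<le> p" using le_upE[of a p] by metis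
  obtain u where "u \<in> LR l (p', up b)" "(u, v) \<in> graph l"
    using LR_onto base ab p' by blast
  moreover have "(p', up b) < (p, up q)" using base(1) by (simp add: ab p' less_le)
  ultimately show ?case using subset_below[of "(p', up b)"] by blast
next
  case (add v w)
  then show ?case using graph_add subspace_add[OF subspace_below] by blast
qed

text \<open>Vectors related to \<open>0\<close> lie in \<open>R\<close> at
  \<open>up (Idx_m 0)\<close>, which is strictly below \<open>up q\<close> because
  \<open>q \<noteq> Idx_m 0\<close>.\<close>

lemma graph_ker:
  assumes "q \<noteq> Idx_m 0" "u \<in> LR l (p, up q)" "(u, 0) \<in> graph l"
  shows "u \<in> below scale (LR l) (p, up q)"
proof -
  have "u \<in> R l (up (Idx_m 0))" unfolding R_up R_m0 using assms by blast
  then have "u \<in> LR l (p, up (Idx_m 0))" using assms by (simp add: LR_def)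
  moreover have "(p, up (Idx_m 0)) < (p, up q)" using assms by (simp add: less_le del: up.simps)
  ultimately show ?thesis using subset_below by blast
qed

lemma graph_coker:
  assumes "p \<noteq> Idx_m 0" "u' \<in> LR (l + 1) (up p, q)" "(0, u') \<in> graph l"
  shows "u' \<in> below scale (LR (l + 1)) (up p, q)"
proof -
  have "u' \<in> L (l + 1) (up (Idx_m 0))" unfolding L_up left.G_m0 using assms by blast
  then have "u' \<in> LR (l + 1) (up (Idx_m 0), q)" using assms by (simp add: LR_def)
  moreover have "(up (Idx_m 0), q) < (up p, q)" using assms by (simp add: less_le del: up.simps)
  ultimately show ?thesis using subset_below by blast
qed

lemma below_LR_subset: "below scale (LR l) r \<subseteq> LR l r"
  by (rule below_subset[OF mono_LR subspace_LR])

section \<open>Propagation of almost gradations along arrows\<close>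

lemma almost_gradation_LR:
  assumes "almost_gradation scale (LR l) C"
  shows "subspace (C r)" "C r \<subseteq> LR l r" "below scale (LR l) r \<inter> C r = {0}"
proof -
  have *: "direct_sum2 scale (LR l r) (below scale (LR l) r) (C r)"
    using assms unfolding almost_gradation_def by blast
  then show "subspace (C r)" "below scale (LR l) r \<inter> C r = {0}" by (simp_all add: direct_sum2_def)
  show "C r \<subseteq> LR l r"
  proof
    fix x assume "x \<in> C r"
    then have "0 + x \<in> below scale (LR l) r + C r" using subspace_0[OF subspace_below] by blast
    then show "x \<in> LR l r" using * by (simp add: direct_sum2_def)
  qed
qed

lemma arrow_isoI:
  assumes "A \<subseteq> V l" "B \<subseteq> V (l + 1)"
    and "\<forall>a\<in>A. \<exists>!b. b \<in> B \<and> (a, b) \<in> graph l" "\<forall>b\<in>B. \<exists>!a. a \<in> A \<and> (a, b) \<in> graph l"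
  shows "arrow_iso l A B"
proof (cases "src l = l")
  case True
  then have g: "(a, b) \<in> graph l \<longleftrightarrow> f l a = b" if "a \<in> A" "b \<in> B" for a b
    using that assms(1,2) by (auto simp: graph_def)
  have "inj_on (f l) A" using assms(3,4) g by (intro inj_onI) metis
  moreover have "f l ` A = B" using assms(3,4) g by (auto; metis image_eqI)
  ultimately show ?thesis by (simp add: arrow_iso_def bij_betw_def True)
next
  case False
  then have g: "(a, b) \<in> graph l \<longleftrightarrow> f l b = a" if "a \<in> A" "b \<in> B" for a b
    using that assms(1,2) by (auto simp: graph_def)
  have "inj_on (f l) B" using assms(3,4) g by (intro inj_onI) metis
  moreover have "f l ` B = A" using assms(3,4) g by (auto; metis image_eqI)
  ultimately show ?thesis by (simp add: arrow_iso_def bij_betw_def False)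
qed

text \<open>The four conditions of \<open>compatible_family\<close> on one arrow merge into one when
  subscripts are moved by \<open>up\<close>.\<close>

definition compat :: "int \<Rightarrow> (idx \<times> idx \<Rightarrow> 'b set) \<Rightarrow> (idx \<times> idx \<Rightarrow> 'b set) \<Rightarrow> bool" where
  "compat l A B \<longleftrightarrow> (\<forall>(p, q)\<in>proper. arrow_iso l (A (p, up q)) (B (up p, q)))"

lemma compat_iff:
  "compat l A B \<longleftrightarrow>
    (\<forall>i\<ge>1. \<forall>j\<ge>1. arrow_iso l (A (Idx_m i, Idx_m (j + 1))) (B (Idx_m (i + 1), Idx_m j))) \<and>
    (\<forall>i\<ge>1. \<forall>j. arrow_iso l (A (Idx_m i, Idx_n (j + 1))) (B (Idx_m (i + 1), Idx_n j))) \<and>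
    (\<forall>i. \<forall>j\<ge>1. arrow_iso l (A (Idx_n i, Idx_m (j + 1))) (B (Idx_n (i + 1), Idx_m j))) \<and>
    (\<forall>i j. arrow_iso l (A (Idx_n i, Idx_n (j + 1))) (B (Idx_n (i + 1), Idx_n j)))"
  (is "_ \<longleftrightarrow> ?R")
proof
  assume *: "compat l A B"
  have "arrow_iso l (A (p, up q)) (B (up p, q))" if "p \<noteq> Idx_m 0" "q \<noteq> Idx_m 0" for p q
    using * that by (auto simp: compat_def)
  from this[of "Idx_m _" "Idx_m _"] this[of "Idx_m _" "Idx_n _"]
    this[of "Idx_n _" "Idx_m _"] this[of "Idx_n _" "Idx_n _"]
  show ?R by simp
next
  assume R: ?R
  have "arrow_iso l (A (p, up q)) (B (up p, q))" if "p \<noteq> Idx_m 0" "q \<noteq> Idx_m 0" for p q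
    using R that by (cases p; cases q) simp_all
  then show "compat l A B" by (auto simp: compat_def proper_def)
qed

lemma compatible_family_iff:
  "compatible_family C0 C \<longleftrightarrow> C 0 = C0 \<and> (\<forall>l. almost_gradation scale (LR l) (C l)) \<and>
    (\<forall>l. compat l (C l) (C (l + 1)))"
  unfolding compatible_family_def compat_iff ..

text \<open>Complements at \<open>l + 1\<close> are chosen index by index: at
  \<open>(up p, q)\<close> with \<open>(p, q)\<close> proper by transferring
  \<open>A (p, up q)\<close> along \<open>graph l\<close>, elsewhere arbitrarily. Injectivity of
  \<open>up\<close> makes the source unique.\<close>

lemma extend_right:
  assumes A: "almost_gradation scale (LR l) A"
  shows "\<exists>B. almost_gradation scale (LR (l + 1)) B \<and> compat l A B"
proof -
  have ex: "\<exists>X. direct_sum2 scale (LR (l + 1) r) (below scale (LR (l + 1)) r) X \<and>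
      (\<forall>p q. (p, q) \<in> proper \<longrightarrow> r = (up p, q) \<longrightarrow> arrow_iso l (A (p, up q)) X)" for r
  proof (cases "\<exists>p q. (p, q) \<in> proper \<and> r = (up p, q)")
    case True
    then obtain p q where pq: "p \<noteq> Idx_m 0" "q \<noteq> Idx_m 0" "r = (up p, q)"
      by (auto simp: proper_def)
    have "\<exists>X. direct_sum2 scale (LR (l + 1) r) (below scale (LR (l + 1)) r) X \<and>
      (\<forall>c\<in>A (p, up q). \<exists>!c'. c' \<in> X \<and> (c, c') \<in> graph l) \<and>
      (\<forall>c'\<in>X. \<exists>!c. c \<in> A (p, up q) \<and> (c, c') \<in> graph l)"
      unfolding pq(3)
      by (rule complement_along_relation[where T = "graph l" and U = "LR l (p, up q)"
            and N = "below scale (LR l) (p, up q)"],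
          rule graph_0, erule (1) graph_add, erule graph_scale,
          rule subspace_LR, rule subspace_below, rule below_LR_subset,
          erule LR_onto, erule LR_total, erule below_onto, erule below_total,
          erule (1) graph_ker[OF pq(2)], erule (1) graph_coker[OF pq(1)],
          rule subspace_LR, rule subspace_below, rule below_LR_subset,
          rule A[unfolded almost_gradation_def, rule_format])
    then obtain X where X: "direct_sum2 scale (LR (l + 1) r) (below scale (LR (l + 1)) r) X"
      "\<forall>c\<in>A (p, up q). \<exists>!c'. c' \<in> X \<and> (c, c') \<in> graph l"
      "\<forall>c'\<in>X. \<exists>!c. c \<in> A (p, up q) \<and> (c, c') \<in> graph l" by blast
    have "X \<subseteq> LR (l + 1) r"
    proof
      fix x assume "x \<in> X"
      then have "0 + x \<in> below scale (LR (l + 1)) r + X" using subspace_0[OF subspace_below] by blast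
      then show "x \<in> LR (l + 1) r" using X(1) by (simp add: direct_sum2_def)
    qed
    then have "arrow_iso l (A (p, up q)) X"
      using X LR_in_V almost_gradation_LR(2)[OF A] by (intro arrow_isoI) blast+
    then show ?thesis using X(1) pq by auto
  next
    case False
    then show ?thesis using complement_exists[OF subspace_below subspace_LR below_LR_subset] by blast
  qed
  obtain B where "\<And>r. direct_sum2 scale (LR (l + 1) r) (below scale (LR (l + 1)) r) (B r)"
    "\<And>r p q. (p, q) \<in> proper \<Longrightarrow> r = (up p, q) \<Longrightarrow> arrow_iso l (A (p, up q)) (B r)" using ex by metis
  then show ?thesis unfolding almost_gradation_def compat_def by blast
qed

text \<open>The same transfer, through the converse relation.\<close>

lemma extend_left:
  assumes B: "almost_gradation scale (LR (l + 1)) B"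
  shows "\<exists>A. almost_gradation scale (LR l) A \<and> compat l A B"
proof -
  have ex: "\<exists>X. direct_sum2 scale (LR l r) (below scale (LR l) r) X \<and>
      (\<forall>p q. (p, q) \<in> proper \<longrightarrow> r = (p, up q) \<longrightarrow> arrow_iso l X (B (up p, q)))" for r
  proof (cases "\<exists>p q. (p, q) \<in> proper \<and> r = (p, up q)")
    case True
    then obtain p q where pq: "p \<noteq> Idx_m 0" "q \<noteq> Idx_m 0" "r = (p, up q)"
      by (auto simp: proper_def)
    have "\<exists>X. direct_sum2 scale (LR l r) (below scale (LR l) r) X \<and>
      (\<forall>c\<in>B (up p, q). \<exists>!c'. c' \<in> X \<and> (c, c') \<in> (graph l)\<inverse>) \<and>
      (\<forall>c'\<in>X. \<exists>!c. c \<in> B (up p, q) \<and> (c, c') \<in> (graph l)\<inverse>)"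
      unfolding pq(3)
      by (rule complement_along_relation[where T = "(graph l)\<inverse>" and U = "LR (l + 1) (up p, q)"
            and N = "below scale (LR (l + 1)) (up p, q)"], unfold converse_iff,
          rule graph_0, erule (1) graph_add, erule graph_scale,
          rule subspace_LR, rule subspace_below, rule below_LR_subset,
          erule LR_total, erule LR_onto, erule below_total, erule below_onto,
          erule (1) graph_coker[OF pq(1)], erule (1) graph_ker[OF pq(2)],
          rule subspace_LR, rule subspace_below, rule below_LR_subset,
          rule B[unfolded almost_gradation_def, rule_format])
    then obtain X where X: "direct_sum2 scale (LR l r) (below scale (LR l) r) X"
      "\<forall>c'\<in>X. \<exists>!c. c \<in> B (up p, q) \<and> (c', c) \<in> graph l"
      "\<forall>c\<in>B (up p, q). \<exists>!c'. c' \<in> X \<and> (c', c) \<in> graph l" by auto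
    have "X \<subseteq> LR l r"
    proof
      fix x assume "x \<in> X"
      then have "0 + x \<in> below scale (LR l) r + X" using subspace_0[OF subspace_below] by blast
      then show "x \<in> LR l r" using X(1) by (simp add: direct_sum2_def)
    qed
    then have "arrow_iso l X (B (up p, q))"
      using X LR_in_V almost_gradation_LR(2)[OF B] by (intro arrow_isoI) blast+
    then show ?thesis using X(1) pq by auto
  next
    case False
    then show ?thesis using complement_exists[OF subspace_below subspace_LR below_LR_subset] by blast
  qed
  obtain A where "\<And>r. direct_sum2 scale (LR l r) (below scale (LR l) r) (A r)"
    "\<And>r p q. (p, q) \<in> proper \<Longrightarrow> r = (p, up q) \<Longrightarrow> arrow_iso l (A r) (B (up p, q))" using ex by metis
  then show ?thesis unfolding almost_gradation_def compat_def by blast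
qed

lemma compatible_family_exists:
  assumes C0: "almost_gradation scale (LR 0) C0"
  shows "\<exists>C. compatible_family C0 C"
proof -
  \<comment> \<open>Two sequences grow from \<open>C0\<close>, one to the right and one to the left;
    the clause for \<open>n = 0\<close> fixes their common start.\<close>
  have "\<exists>A. \<forall>n. (almost_gradation scale (LR (int n)) (A n) \<and> (n = 0 \<longrightarrow> A n = C0)) \<and>
      compat (int n) (A n) (A (Suc n))"
    using C0 extend_right by (intro dependent_nat_choice) (auto simp: add.commute[of 1])
  then obtain A where A: "\<And>n. almost_gradation scale (LR (int n)) (A n)" "A 0 = C0"
    "\<And>n. compat (int n) (A n) (A (Suc n))" by blast
  \<comment> \<open>Term \<open>n\<close> of the left sequence lives at \<open>- int n\<close>; the
    arrow from there to the next vertex on the left has number \<open>- int n - 1\<close>.\<close>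
  have "\<exists>B. \<forall>n. (almost_gradation scale (LR (- int n)) (B n) \<and> (n = 0 \<longrightarrow> B n = C0)) \<and>
      compat (- int n - 1) (B (Suc n)) (B n)"
  proof (rule dependent_nat_choice)
    fix x n assume "almost_gradation scale (LR (- int n)) x \<and> (n = 0 \<longrightarrow> x = C0)"
    moreover have e: "- int (Suc n) = - int n - 1" by simp
    ultimately show "\<exists>y. (almost_gradation scale (LR (- int (Suc n))) y \<and> (Suc n = 0 \<longrightarrow> y = C0)) \<and>
        compat (- int n - 1) y x"
      unfolding e using extend_left[of "- int n - 1" x] by simp
  qed (use C0 in auto)
  then obtain B where B: "\<And>n. almost_gradation scale (LR (- int n)) (B n)" "B 0 = C0"
    "\<And>n. compat (- int n - 1) (B (Suc n)) (B n)" by blast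
  define C where "C l = (if l \<ge> 0 then A (nat l) else B (nat (- l)))" for l
  have CB: "C (- int n) = B n" for n by (cases "n = 0") (simp_all add: C_def A(2) B(2))
  have CA: "C (int n) = A n" for n by (simp add: C_def)
  have "almost_gradation scale (LR l) (C l)" for l
    by (cases l rule: int_cases2) (simp_all add: CA CB A B)
  moreover have "compat l (C l) (C (l + 1))" for l
  proof (cases "l \<ge> 0")
    case True
    then obtain n where "l = int n" by (rule nonneg_int_cases)
    then show ?thesis using A(3)[of n] CA[of n] CA[of "Suc n"] by (simp add: add.commute)
  next
    case False
    define n where "n = nat (- l - 1)"
    have n: "l = - int (Suc n)" "l + 1 = - int n" "l = - int n - 1"
      using False by (simp_all add: n_def)
    show ?thesis using B(3)[of n] CB[of n] CB[of "Suc n"] n by metis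
  qed
  moreover have "C 0 = C0" by (simp add: C_def A)
  ultimately show ?thesis unfolding compatible_family_iff by blast
qed

section \<open>Almost gradations as direct sum decompositions\<close>

lemma almost_gradation_direct_sum:
  assumes C: "almost_gradation scale (LR l) C"
  shows "direct_sum scale (V l) UNIV C"
proof -
  obtain B where B: "finite B" "V l = span B" using finite_span_V by blast
  note C' = C[unfolded LR_def]
  \<comment> \<open>The whole space is the step of \<open>LR\<close> at the top index, so the
    spanning lemma applies to it.\<close>
  have "V l = L l (Idx_n 0) \<inter> R l (Idx_n 0)" by (simp add: left.G_n0 R_n0)
  also have "\<dots> \<subseteq> span (\<Union>r. C r)"
    by (rule almost_gradation_span[OF left.mono_G left.subspace_G left.G_in_V[of l, unfolded B(2)]
          left.G_least mono_R subspace_R R_in_V[of l, unfolded B(2)] R_least B(1) C'])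
  finally have "V l \<subseteq> span (\<Union>r. C r)" .
  moreover have "span (\<Union>r. C r) \<subseteq> V l"
    using almost_gradation_LR(2)[OF C] LR_in_V by (intro span_minimal subspace_V) blast
  moreover have "\<forall>K w. finite K \<and> K \<subseteq> UNIV \<and> (\<forall>r\<in>K. w r \<in> C r) \<and> (\<Sum>r\<in>K. w r) = 0
      \<longrightarrow> (\<forall>r\<in>K. w r = 0)"
    using almost_gradation_independent[OF left.mono_G left.subspace_G mono_R subspace_R C']
    by (intro allI impI) (elim conjE, rule, blast+)
  ultimately show ?thesis unfolding direct_sum_def
    using almost_gradation_LR(1)[OF C] by (simp add: subset_antisym)
qed

section \<open>The summands \<open>E\<close> of a compatible family\<close>

context
  fixes C0 C
  assumes compatible: "compatible_family C0 C"
begin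

lemma almost_gradation_C: "almost_gradation scale (LR l) (C l)"
  using compatible by (simp add: compatible_family_iff)

lemmas C_facts = almost_gradation_LR[OF almost_gradation_C]

lemma E_eq: "(s, t) \<in> parameters \<Longrightarrow> E C s t l = span (\<Union>r\<in>{r\<in>proper. params l r = (s, t)}. C l r)"
  by (rule E_eq_span) (simp_all add: C_facts)

text \<open>\<open>C l\<close> decomposes \<open>V l\<close>; once the zero summands at improper
  indices are dropped, grouping by \<open>params l\<close> yields the \<open>E\<close>.\<close>

lemma direct_sum_E: "direct_sum scale (V l) parameters (\<lambda>(s, t). E C s t l)"
proof -
  have "direct_sum scale (V l) proper (C l)"
  proof (rule direct_sum_restrict[OF almost_gradation_direct_sum[OF almost_gradation_C]])
    fix r assume "r \<in> UNIV - proper"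
    then show "C l r = {0}" using C_facts(2)[of l r] LR_m0[of r l] subspace_0[OF C_facts(1)] by blast
  qed simp
  then have "direct_sum scale (V l) parameters
      (\<lambda>j. span (\<Union>r\<in>{r\<in>proper. params l r = j}. C l r))"
    by (rule direct_sum_group) (auto simp: params_in)
  then show ?thesis
  proof (rule direct_sum_cong)
    fix j assume "j \<in> parameters"
    then show "span (\<Union>r\<in>{r\<in>proper. params l r = j}. C l r) = (\<lambda>(s, t). E C s t l) j"
      using E_eq by (cases j) auto
  qed
qed

text \<open>If arrow \<open>l\<close> starts at \<open>l\<close>, every vector of \<open>V l\<close>
  has an image in \<open>V (l + 1)\<close>. So \<open>R l\<close> already fills \<open>V l\<close>
  at \<open>up (Idx_n 0)\<close>, and nothing new appears at the top index.\<close>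

lemma C_n0_right:
  assumes "src l = l" shows "C l (p, Idx_n 0) = {0}"
proof -
  have "V l \<subseteq> R l (up (Idx_n 0))"
    unfolding R_up R_n0 using assms f_in[of _ l] src_tgt[of l] by (auto simp: graph_def)
  then have "LR l (p, Idx_n 0) \<subseteq> LR l (p, up (Idx_n 0))" using R_in_V by (auto simp: LR_def)
  also have "(p, up (Idx_n 0)) < (p, Idx_n 0)" by (simp add: less_le)
  then have "LR l (p, up (Idx_n 0)) \<subseteq> below scale (LR l) (p, Idx_n 0)" by (rule subset_below)
  finally show ?thesis using C_facts(2,3)[of l "(p, Idx_n 0)"] by blast
qed

lemma C_n0_left:
  assumes "src l \<noteq> l" shows "C (l + 1) (Idx_n 0, q) = {0}"
proof -
  have "V (l + 1) \<subseteq> L (l + 1) (up (Idx_n 0))"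
    unfolding L_up left.G_n0 using assms f_in[of _ l] src_tgt[of l] by (auto simp: graph_def)
  then have "LR (l + 1) (Idx_n 0, q) \<subseteq> LR (l + 1) (up (Idx_n 0), q)"
    using left.G_in_V by (auto simp: LR_def)
  also have "(up (Idx_n 0), q) < (Idx_n 0, q)" by (simp add: less_le)
  then have "LR (l + 1) (up (Idx_n 0), q) \<subseteq> below scale (LR (l + 1)) (Idx_n 0, q)"
    by (rule subset_below)
  finally show ?thesis using C_facts(2,3)[of "l + 1" "(Idx_n 0, q)"] by blast
qed

lemma C_arrow: "(p, q) \<in> proper \<Longrightarrow> arrow_iso l (C l (p, up q)) (C (l + 1) (up p, q))"
  using compatible unfolding compatible_family_iff compat_def by blast

text \<open>In the direction of the arrow, one index of a summand is lowered by undoing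
  \<open>up\<close>. Compatibility then gives a summand with the same interval, unless that index is
  \<open>Idx_n 0\<close>, where the summand is zero, or \<open>Idx_m 1\<close>, where it is
  killed.\<close>

lemma f_C:
  assumes r: "r \<in> proper" and x: "x \<in> C (src l) r"
  shows "f l x = 0 \<or> (\<exists>r'\<in>proper. params (tgt l) r' = params (src l) r \<and> f l x \<in> C (tgt l) r')"
proof -
  obtain p q where pq: "r = (p, q)" "p \<noteq> Idx_m 0" "q \<noteq> Idx_m 0" using r by (cases r) (auto simp: proper_def)
  show ?thesis
  proof (cases "src l = l")
    case True
    have x': "x \<in> C l (p, q)" using x True pq by simp
    show ?thesis
    proof (cases q rule: idx_up_cases)
      case 2
      then show ?thesis using x' C_n0_right[OF True] f_0 by simp
    next
      case (3 q')
      show ?thesis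
      proof (cases "q' = Idx_m 0")
        \<comment> \<open>Here \<open>q\<close> is \<open>Idx_m 1\<close>: the interval ends at
          \<open>l\<close>, and \<open>x\<close> lies in the preimage of zero.\<close>
        case True
        then have "x \<in> R l (up (Idx_m 0))" using x' C_facts(2)[of l "(p, q)"] 3 by (auto simp: LR_def)
        then show ?thesis unfolding R_up R_m0 using \<open>src l = l\<close> by (auto simp: graph_def)
      next
        case False
        then have "f l x \<in> C (l + 1) (up p, q')"
          using C_arrow[of p q' l] pq 3 x' \<open>src l = l\<close> by (auto simp: arrow_iso_def bij_betw_def)
        moreover have "(up p, q') \<in> proper" using False pq by (cases p) (auto simp: proper_def)
        ultimately show ?thesis using src_tgt(1)[OF True] True pq 3
          by (intro disjI2 bexI[of _ "(up p, q')"]) (simp_all add: params_def)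
      qed
    qed (use pq in simp)
  next
    case src: False
    have x': "x \<in> C (l + 1) (p, q)" using x src_tgt(2)[OF src] pq by simp
    show ?thesis
    proof (cases p rule: idx_up_cases)
      case 2
      then show ?thesis using x' C_n0_left[OF src] f_0 by simp
    next
      case (3 p')
      show ?thesis
      proof (cases "p' = Idx_m 0")
        \<comment> \<open>Here \<open>p\<close> is \<open>Idx_m 1\<close>: the interval begins at
          \<open>l + 1\<close>, and the arrow leads out of it.\<close>
        case True
        then have "x \<in> L (l + 1) (up (Idx_m 0))"
          using x' C_facts(2)[of "l + 1" "(p, q)"] 3 by (auto simp: LR_def)
        then show ?thesis unfolding L_up left.G_m0 using src by (auto simp: graph_def)
      next
        case False
        then have "f l x \<in> C l (p', up q)"
          using C_arrow[of p' q l] pq 3 x' src by (auto simp: arrow_iso_def bij_betw_def)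
        moreover have "(p', up q) \<in> proper" using False pq by (cases q) (auto simp: proper_def)
        ultimately show ?thesis using src_tgt[of l] src pq 3
          by (intro disjI2 bexI[of _ "(p', up q)"]) (simp_all add: params_def)
      qed
    qed (use pq in simp)
  qed
qed

lemma subrep_E:
  assumes st: "(s, t) \<in> parameters" shows "subrep (E C s t)"
proof -
  have "E C s t l \<subseteq> V l" for l
    unfolding E_eq[OF st] using C_facts(2) LR_in_V by (intro span_minimal subspace_V) blast
  moreover have "f l ` E C s t (src l) \<subseteq> E C s t (tgt l)" for l
  proof -
    \<comment> \<open>As \<open>?S\<close> is a subspace, it suffices to test the generators
      \<open>C (src l) r\<close>, which \<open>f_C\<close> handles.\<close>
    let ?S = "{x \<in> V (src l). f l x \<in> E C s t (tgt l)}"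
    have sub: "subspace (E C s t (tgt l))" unfolding E_eq[OF st] by (rule subspace_span)
    have "subspace ?S"
      using subspace_0[OF sub] subspace_add[OF sub] subspace_scale[OF sub]
      by (intro subspaceI) (auto simp: f_0 f_add f_scale subspace_0[OF subspace_V]
          subspace_add[OF subspace_V] subspace_scale[OF subspace_V])
    moreover have "C (src l) r \<subseteq> ?S" if r: "r \<in> proper" "params (src l) r = (s, t)" for r
    proof
      fix x assume x: "x \<in> C (src l) r"
      have "f l x \<in> E C s t (tgt l)"
        using f_C[OF r(1) x]
      proof (elim disjE bexE conjE)
        assume "f l x = 0"
        then show ?thesis using subspace_0[OF sub] by simp
      next
        fix r' assume "r' \<in> proper" "params (tgt l) r' = params (src l) r" "f l x \<in> C (tgt l) r'"
        then show ?thesis unfolding E_eq[OF st] using r by (intro span_base UN_I[of r']) auto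
      qed
      then show "x \<in> ?S" using x C_facts(2) LR_in_V by blast
    qed
    ultimately have "E C s t (src l) \<subseteq> ?S"
      unfolding E_eq[OF st, of "src l"] by (intro span_minimal) blast+
    then show ?thesis by blast
  qed
  ultimately show ?thesis unfolding subrep_def by (simp add: E_eq[OF st])
qed

end

end

theorem theorem1:
  fixes scale :: "'a::field \<Rightarrow> 'b::ab_group_add \<Rightarrow> 'b"
    and src tgt :: "int \<Rightarrow> int"
    and V :: "int \<Rightarrow> 'b set"
    and f :: "int \<Rightarrow> 'b \<Rightarrow> 'b"
    and C0 :: "idx \<times> idx \<Rightarrow> 'b set"
  assumes "quiver_rep scale src tgt V f"
    and "quiver_rep.locally_finite_dim scale V"
    and "almost_gradation scale (quiver_rep.LR src V f 0) C0"
  shows "(\<exists>C. quiver_rep.compatible_family scale src V f C0 C) \<and>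
    (\<forall>C. quiver_rep.compatible_family scale src V f C0 C \<longrightarrow>
       (\<forall>(s, t)\<in>parameters. quiver_rep.subrep scale src tgt V f (E C s t)) \<and>
       (\<forall>l. direct_sum scale (V l) parameters (\<lambda>(s, t). E C s t l)))"
proof -
  interpret lfd_quiver_rep scale src tgt V f
    using assms(1,2) by (intro lfd_quiver_rep.intro lfd_quiver_rep_axioms.intro)
  show ?thesis using compatible_family_exists[OF assms(3)] subrep_E direct_sum_E by blast
qed

end
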